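(* Let $R$ be a ring and let $M$ be a projective right $R$-module. Then the following are equivalent: (1) $M$ is principally $\delta$-semiperfect; (2) $M$ is principally $\delta$-lifting.
   Context: Rings have an identity and modules are unital right modules. A submodule $N$ of a module $M$ is $\delta$-small in $M$ if, whenever $M=N+X$ for a submodule $X$ with $M/X$ singular, one has $M=X$. A module $M$ is principally $\delta$-lifting if for each $m\in M$ there is a decomposition $M=A\oplus B$ with $A\leq mR$ and $mR\cap B$ $\delta$-small in $B$. A projective module $P$ is a projective $\delta$-cover of a module $L$ if there is an epimorphism $f:P\to L$ with $\operatorname{Ker} f$ $\delta$-small in $P$. A module $M$ is principally $\delta$-semiperfect if for every $m\in M$ the factor module $M/mR$ has a projective $\delta$-cover. *)

theory Defs
  imports "HOL-Algebra.AbelCoset" "HOL-Algebra.Module"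
begin

text \<open>
  The locale \<^locale>\<open>module\<close> of the library is restricted to commutative rings and left scalar
  multiplication, hence the following right modules over an arbitrary ring.  As for the library's
  modules, the fields \<open>mult\<close> and \<open>one\<close> inherited from the ring record carry no information.
\<close>

record ('r, 'm) rmodule = "'m ring" +
  rsmult :: "['m, 'r] \<Rightarrow> 'm" (infixl \<open>\<cdot>\<index>\<close> 70)

locale right_module = R?: ring R + M?: abelian_group M
  for R :: "('r, 'x) ring_scheme" (structure) and M :: "('r, 'm, 'y) rmodule_scheme" (structure) +
  assumes rsmult_closed [simp, intro]:
      "\<lbrakk>x \<in> carrier M; r \<in> carrier R\<rbrakk> \<Longrightarrow> x \<cdot>\<^bsub>M\<^esub> r \<in> carrier M"
    and rsmult_l_distr:
      "\<lbrakk>x \<in> carrier M; y \<in> carrier M; r \<in> carrier R\<rbrakk>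
        \<Longrightarrow> (x \<oplus>\<^bsub>M\<^esub> y) \<cdot>\<^bsub>M\<^esub> r = x \<cdot>\<^bsub>M\<^esub> r \<oplus>\<^bsub>M\<^esub> y \<cdot>\<^bsub>M\<^esub> r"
    and rsmult_r_distr:
      "\<lbrakk>x \<in> carrier M; r \<in> carrier R; s \<in> carrier R\<rbrakk>
        \<Longrightarrow> x \<cdot>\<^bsub>M\<^esub> (r \<oplus>\<^bsub>R\<^esub> s) = x \<cdot>\<^bsub>M\<^esub> r \<oplus>\<^bsub>M\<^esub> x \<cdot>\<^bsub>M\<^esub> s"
    and rsmult_assoc:
      "\<lbrakk>x \<in> carrier M; r \<in> carrier R; s \<in> carrier R\<rbrakk>
        \<Longrightarrow> x \<cdot>\<^bsub>M\<^esub> (r \<otimes>\<^bsub>R\<^esub> s) = x \<cdot>\<^bsub>M\<^esub> r \<cdot>\<^bsub>M\<^esub> s"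
    and rsmult_one [simp]:
      "x \<in> carrier M \<Longrightarrow> x \<cdot>\<^bsub>M\<^esub> \<one>\<^bsub>R\<^esub> = x"

definition regular_rmodule :: "('r, 'x) ring_scheme \<Rightarrow> ('r, 'r) rmodule"
  where "regular_rmodule R =
    \<lparr>carrier = carrier R, mult = undefined, one = undefined,
     zero = \<zero>\<^bsub>R\<^esub>, add = add R, rsmult = mult R\<rparr>"

definition rsubmodule ::
    "('r, 'x) ring_scheme \<Rightarrow> ('r, 'm, 'y) rmodule_scheme \<Rightarrow> 'm set \<Rightarrow> bool"
  where "rsubmodule R M N \<longleftrightarrow>
    additive_subgroup N M \<and> (\<forall>x\<in>N. \<forall>r\<in>carrier R. x \<cdot>\<^bsub>M\<^esub> r \<in> N)"

definition cyclic_rsubmodule ::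
    "('r, 'x) ring_scheme \<Rightarrow> ('r, 'm, 'y) rmodule_scheme \<Rightarrow> 'm \<Rightarrow> 'm set"
  where "cyclic_rsubmodule R M m = {m \<cdot>\<^bsub>M\<^esub> r | r. r \<in> carrier R}"

definition factor_rmodule :: "('r, 'm) rmodule \<Rightarrow> 'm set \<Rightarrow> ('r, 'm set) rmodule"
  where "factor_rmodule M N =
    \<lparr>carrier = a_rcosets\<^bsub>M\<^esub> N, mult = undefined, one = undefined,
     zero = N, add = set_add M,
     rsmult = (\<lambda>C r. \<Union>x\<in>C. N +>\<^bsub>M\<^esub> (x \<cdot>\<^bsub>M\<^esub> r))\<rparr>"

definition rmodule_hom ::
    "('r, 'x) ring_scheme \<Rightarrow> ('r, 'm) rmodule \<Rightarrow> ('r, 'n) rmodule \<Rightarrow> ('m \<Rightarrow> 'n) set"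
  where "rmodule_hom R M N =
    {f \<in> carrier M \<rightarrow> carrier N.
       (\<forall>x\<in>carrier M. \<forall>y\<in>carrier M. f (x \<oplus>\<^bsub>M\<^esub> y) = f x \<oplus>\<^bsub>N\<^esub> f y) \<and>
       (\<forall>x\<in>carrier M. \<forall>r\<in>carrier R. f (x \<cdot>\<^bsub>M\<^esub> r) = f x \<cdot>\<^bsub>N\<^esub> r)}"

definition rmodule_epi ::
    "('r, 'x) ring_scheme \<Rightarrow> ('r, 'm) rmodule \<Rightarrow> ('r, 'n) rmodule \<Rightarrow> ('m \<Rightarrow> 'n) set"
  where "rmodule_epi R M N = {f \<in> rmodule_hom R M N. f ` carrier M = carrier N}"

text \<open>
  The lifting property ranges over modules \<open>A\<close> on the type \<open>'m \<Rightarrow> 'r\<close> and \<open>B\<close> on the type \<open>'m\<close>,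
  because a definition in HOL cannot quantify over types.  These types suffice: they admit the
  canonical epimorphism from the free module \<open>R\<^sup>(\<^sup>M\<^sup>)\<close> onto \<open>M\<close>, and lemma
  \<open>projective_rmodule_lift\<close> below derives the lifting property for modules on arbitrary types.
\<close>

definition projective_rmodule :: "('r, 'x) ring_scheme \<Rightarrow> ('r, 'm) rmodule \<Rightarrow> bool"
  where "projective_rmodule R M \<longleftrightarrow>
    right_module R M \<and>
    (\<forall>(A :: ('r, 'm \<Rightarrow> 'r) rmodule) (B :: ('r, 'm) rmodule) g f.
       right_module R A \<and> right_module R B \<and> g \<in> rmodule_epi R A B \<and> f \<in> rmodule_hom R M B
       \<longrightarrow> (\<exists>h\<in>rmodule_hom R M A. \<forall>x\<in>carrier M. g (h x) = f x))"

definition essential_rsubmodule ::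
    "('r, 'x) ring_scheme \<Rightarrow> ('r, 'm) rmodule \<Rightarrow> 'm set \<Rightarrow> bool"
  where "essential_rsubmodule R M N \<longleftrightarrow>
    rsubmodule R M N \<and>
    (\<forall>K. rsubmodule R M K \<and> K \<noteq> {\<zero>\<^bsub>M\<^esub>} \<longrightarrow> N \<inter> K \<noteq> {\<zero>\<^bsub>M\<^esub>})"

definition r_annihilator ::
    "('r, 'x) ring_scheme \<Rightarrow> ('r, 'm) rmodule \<Rightarrow> 'm \<Rightarrow> 'r set"
  where "r_annihilator R M m = {r \<in> carrier R. m \<cdot>\<^bsub>M\<^esub> r = \<zero>\<^bsub>M\<^esub>}"

text \<open>
  \<open>Z(M)\<close>, the set of the elements whose right annihilator is an essential right ideal; right ideals
  are the submodules of the right regular module.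
\<close>

definition singular_rsubmodule :: "('r, 'x) ring_scheme \<Rightarrow> ('r, 'm) rmodule \<Rightarrow> 'm set"
  where "singular_rsubmodule R M =
    {m \<in> carrier M. essential_rsubmodule R (regular_rmodule R) (r_annihilator R M m)}"

definition singular_rmodule :: "('r, 'x) ring_scheme \<Rightarrow> ('r, 'm) rmodule \<Rightarrow> bool"
  where "singular_rmodule R M \<longleftrightarrow> singular_rsubmodule R M = carrier M"

definition delta_small :: "('r, 'x) ring_scheme \<Rightarrow> ('r, 'm) rmodule \<Rightarrow> 'm set \<Rightarrow> bool"
  where "delta_small R M N \<longleftrightarrow>
    rsubmodule R M N \<and>
    (\<forall>X. rsubmodule R M X \<and> carrier M = N <+>\<^bsub>M\<^esub> X \<and> singular_rmodule R (factor_rmodule M X)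
       \<longrightarrow> carrier M = X)"

definition direct_decomposition ::
    "('r, 'x) ring_scheme \<Rightarrow> ('r, 'm) rmodule \<Rightarrow> 'm set \<Rightarrow> 'm set \<Rightarrow> bool"
  where "direct_decomposition R M A B \<longleftrightarrow>
    rsubmodule R M A \<and> rsubmodule R M B \<and>
    carrier M = A <+>\<^bsub>M\<^esub> B \<and> A \<inter> B = {\<zero>\<^bsub>M\<^esub>}"

definition principally_delta_lifting ::
    "('r, 'x) ring_scheme \<Rightarrow> ('r, 'm) rmodule \<Rightarrow> bool"
  where "principally_delta_lifting R M \<longleftrightarrow>
    (\<forall>m\<in>carrier M. \<exists>A B. direct_decomposition R M A B \<and>
       A \<subseteq> cyclic_rsubmodule R M m \<and>
       delta_small R (M\<lparr>carrier := B\<rparr>) (cyclic_rsubmodule R M m \<inter> B))"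

definition projective_delta_cover ::
    "('r, 'x) ring_scheme \<Rightarrow> ('r, 'p) rmodule \<Rightarrow> ('p \<Rightarrow> 'l) \<Rightarrow> ('r, 'l) rmodule \<Rightarrow> bool"
  where "projective_delta_cover R P f L \<longleftrightarrow>
    projective_rmodule R P \<and> f \<in> rmodule_epi R P L \<and> delta_small R P (a_kernel P L f)"

text \<open>
  Again the module \<open>P\<close> has to live on a fixed type, and \<open>'l \<Rightarrow> 'r\<close> is large enough.  Lemma
  \<open>has_projective_delta_coverI\<close> below shows that a projective \<open>\<delta>\<close>-cover on any type yields one on
  this type.
\<close>

definition has_projective_delta_cover ::
    "('r, 'x) ring_scheme \<Rightarrow> ('r, 'l) rmodule \<Rightarrow> bool"
  where "has_projective_delta_cover R L \<longleftrightarrow>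
    (\<exists>(P :: ('r, 'l \<Rightarrow> 'r) rmodule) f. projective_delta_cover R P f L)"

definition principally_delta_semiperfect ::
    "('r, 'x) ring_scheme \<Rightarrow> ('r, 'm) rmodule \<Rightarrow> bool"
  where "principally_delta_semiperfect R M \<longleftrightarrow>
    (\<forall>m\<in>carrier M.
       has_projective_delta_cover R (factor_rmodule M (cyclic_rsubmodule R M m)))"


subsection \<open>The lifting property of projective modules on arbitrary types\<close>

definition free_rmodule :: "('r, 'x) ring_scheme \<Rightarrow> 'i set \<Rightarrow> ('r, 'i \<Rightarrow> 'r) rmodule"
  where "free_rmodule R S =
    \<lparr>carrier = {\<phi>. range \<phi> \<subseteq> carrier R \<and> finite {p. \<phi> p \<noteq> \<zero>\<^bsub>R\<^esub>} \<and> {p. \<phi> p \<noteq> \<zero>\<^bsub>R\<^esub>} \<subseteq> S},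
     mult = undefined, one = undefined, zero = (\<lambda>_. \<zero>\<^bsub>R\<^esub>),
     add = (\<lambda>\<phi> \<psi> p. \<phi> p \<oplus>\<^bsub>R\<^esub> \<psi> p), rsmult = (\<lambda>\<phi> r p. \<phi> p \<otimes>\<^bsub>R\<^esub> r)\<rparr>"

definition free_ext ::
    "('r, 'x) ring_scheme \<Rightarrow> ('r, 'm) rmodule \<Rightarrow> ('i \<Rightarrow> 'm) \<Rightarrow> ('i \<Rightarrow> 'r) \<Rightarrow> 'm"
  where "free_ext R N a \<phi> = finsum N (\<lambda>p. a p \<cdot>\<^bsub>N\<^esub> \<phi> p) {p. \<phi> p \<noteq> \<zero>\<^bsub>R\<^esub>}"

context right_module
begin

lemma rsmult_zero_right [simp]:
  assumes "x \<in> carrier M" shows "x \<cdot>\<^bsub>M\<^esub> \<zero>\<^bsub>R\<^esub> = \<zero>\<^bsub>M\<^esub>"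
proof -
  have "x \<cdot>\<^bsub>M\<^esub> \<zero>\<^bsub>R\<^esub> \<oplus>\<^bsub>M\<^esub> x \<cdot>\<^bsub>M\<^esub> \<zero>\<^bsub>R\<^esub> = x \<cdot>\<^bsub>M\<^esub> \<zero>\<^bsub>R\<^esub>"
    using rsmult_r_distr[of x "\<zero>\<^bsub>R\<^esub>" "\<zero>\<^bsub>R\<^esub>"] assms by simp
  then show ?thesis using assms
    by (metis M.add.r_cancel_one' R.zero_closed rsmult_closed)
qed

lemma rsmult_zero_left [simp]:
  assumes "r \<in> carrier R" shows "\<zero>\<^bsub>M\<^esub> \<cdot>\<^bsub>M\<^esub> r = \<zero>\<^bsub>M\<^esub>"
proof -
  have "\<zero>\<^bsub>M\<^esub> \<cdot>\<^bsub>M\<^esub> r \<oplus>\<^bsub>M\<^esub> \<zero>\<^bsub>M\<^esub> \<cdot>\<^bsub>M\<^esub> r = \<zero>\<^bsub>M\<^esub> \<cdot>\<^bsub>M\<^esub> r"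
    using rsmult_l_distr[of "\<zero>\<^bsub>M\<^esub>" "\<zero>\<^bsub>M\<^esub>" r] assms by simp
  then show ?thesis using assms
    by (metis M.add.r_cancel_one' M.zero_closed rsmult_closed)
qed

end

lemma rmodule_hom_finsum:
  assumes M: "right_module R M" and N: "right_module R N" and f: "f \<in> rmodule_hom R M N"
    and "finite T" and "g \<in> T \<rightarrow> carrier M"
  shows "f (finsum M g T) = finsum N (\<lambda>p. f (g p)) T"
proof -
  interpret M: right_module R M by (fact M)
  interpret N: right_module R N by (fact N)
  have z: "f \<zero>\<^bsub>M\<^esub> = \<zero>\<^bsub>N\<^esub>"
  proof -
    have "f (\<zero>\<^bsub>M\<^esub> \<cdot>\<^bsub>M\<^esub> \<zero>\<^bsub>R\<^esub>) = f \<zero>\<^bsub>M\<^esub> \<cdot>\<^bsub>N\<^esub> \<zero>\<^bsub>R\<^esub>"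
      using f M.R.zero_closed M.M.zero_closed unfolding rmodule_hom_def by blast
    moreover have "f \<zero>\<^bsub>M\<^esub> \<in> carrier N"
      using f M.M.zero_closed unfolding rmodule_hom_def by blast
    ultimately show ?thesis by simp
  qed
  show ?thesis using assms(4,5)
  proof (induction T rule: finite_induct)
    case empty then show ?case using z by simp
  next
    case (insert x T)
    have 1: "finsum M g T \<in> carrier M" "g x \<in> carrier M"
      using insert by (auto intro: M.M.finsum_closed)
    have 2: "(\<lambda>p. f (g p)) \<in> T \<rightarrow> carrier N" "f (g x) \<in> carrier N"
      using insert f unfolding rmodule_hom_def by auto
    have "f (g x \<oplus>\<^bsub>M\<^esub> finsum M g T) = f (g x) \<oplus>\<^bsub>N\<^esub> f (finsum M g T)"
      using f 1 unfolding rmodule_hom_def by blast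
    then show ?case using insert 1 2 by (simp add: Pi_iff)
  qed
qed

lemma free_rmodule_right_module:
  assumes "ring R" shows "right_module R (free_rmodule R S)"
proof -
  interpret R: ring R by (fact assms)
  have sub: "{p. \<phi> p \<oplus>\<^bsub>R\<^esub> \<psi> p \<noteq> \<zero>\<^bsub>R\<^esub>} \<subseteq> {p. \<phi> p \<noteq> \<zero>\<^bsub>R\<^esub>} \<union> {p. \<psi> p \<noteq> \<zero>\<^bsub>R\<^esub>}" for \<phi> \<psi> :: "'c \<Rightarrow> 'a"
    by auto
  have fin: "finite {p. \<phi> p \<oplus>\<^bsub>R\<^esub> \<psi> p \<noteq> \<zero>\<^bsub>R\<^esub>}"
    if "finite {p. \<phi> p \<noteq> \<zero>\<^bsub>R\<^esub>}" "finite {p. \<psi> p \<noteq> \<zero>\<^bsub>R\<^esub>}" for \<phi> \<psi> :: "'c \<Rightarrow> 'a"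
    using finite_subset[OF sub] that by auto
  have "abelian_group (free_rmodule R S)"
  proof (rule abelian_groupI)
    fix \<phi> \<psi>
    assume "\<phi> \<in> carrier (free_rmodule R S)" "\<psi> \<in> carrier (free_rmodule R S)"
    then show "\<phi> \<oplus>\<^bsub>free_rmodule R S\<^esub> \<psi> \<in> carrier (free_rmodule R S)"
      using fin[of \<phi> \<psi>] sub[of \<phi> \<psi>] by (auto simp: free_rmodule_def image_subset_iff)
  next
    show "\<zero>\<^bsub>free_rmodule R S\<^esub> \<in> carrier (free_rmodule R S)" by (auto simp: free_rmodule_def)
  next
    fix \<phi> assume A: "\<phi> \<in> carrier (free_rmodule R S)"
    show "\<exists>\<psi>\<in>carrier (free_rmodule R S). \<psi> \<oplus>\<^bsub>free_rmodule R S\<^esub> \<phi> = \<zero>\<^bsub>free_rmodule R S\<^esub>"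
    proof
      have "\<ominus>\<^bsub>R\<^esub> \<phi> p = \<zero>\<^bsub>R\<^esub> \<longleftrightarrow> \<phi> p = \<zero>\<^bsub>R\<^esub>" for p
        using A unfolding free_rmodule_def by (auto simp: image_subset_iff)
      with A show "(\<lambda>p. \<ominus>\<^bsub>R\<^esub> \<phi> p) \<in> carrier (free_rmodule R S)"
        by (auto simp: free_rmodule_def)
      show "(\<lambda>p. \<ominus>\<^bsub>R\<^esub> \<phi> p) \<oplus>\<^bsub>free_rmodule R S\<^esub> \<phi> = \<zero>\<^bsub>free_rmodule R S\<^esub>"
        using A by (auto simp: free_rmodule_def image_subset_iff R.l_neg)
    qed
  qed (auto simp: free_rmodule_def image_subset_iff R.a_ac fun_eq_iff)
  moreover have "(\<lambda>p. \<phi> p \<otimes>\<^bsub>R\<^esub> r) \<in> carrier (free_rmodule R S)"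
    if "\<phi> \<in> carrier (free_rmodule R S)" "r \<in> carrier R" for \<phi> r
  proof -
    have "{p. \<phi> p \<otimes>\<^bsub>R\<^esub> r \<noteq> \<zero>\<^bsub>R\<^esub>} \<subseteq> {p. \<phi> p \<noteq> \<zero>\<^bsub>R\<^esub>}" using that by auto
    then show ?thesis using that
      by (auto simp: free_rmodule_def image_subset_iff dest: finite_subset)
  qed
  ultimately show ?thesis using assms
    by (intro right_module.intro right_module_axioms.intro)
      (auto simp: free_rmodule_def image_subset_iff fun_eq_iff R.l_distr R.r_distr R.m_assoc)
qed

lemma free_ext_superset:
  assumes N: "right_module R N" and a: "a \<in> S \<rightarrow> carrier N"
    and phi: "\<phi> \<in> carrier (free_rmodule R S)"
    and T: "finite T" "{p. \<phi> p \<noteq> \<zero>\<^bsub>R\<^esub>} \<subseteq> T" "T \<subseteq> S"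
  shows "free_ext R N a \<phi> = finsum N (\<lambda>p. a p \<cdot>\<^bsub>N\<^esub> \<phi> p) T"
proof -
  interpret N: right_module R N by (fact N)
  show ?thesis unfolding free_ext_def
    using a phi T
    by (intro N.M.add.finprod_mono_neutral_cong_left)
      (auto simp: free_rmodule_def image_subset_iff Pi_iff subset_iff)
qed

lemma free_ext_hom:
  assumes N: "right_module R N" and a: "a \<in> S \<rightarrow> carrier N"
  shows "free_ext R N a \<in> rmodule_hom R (free_rmodule R S) N"
proof -
  interpret N: right_module R N by (fact N)
  interpret F: right_module R "free_rmodule R S"
    by (rule free_rmodule_right_module) (rule N.R.ring_axioms)
  have cl: "(\<lambda>p. a p \<cdot>\<^bsub>N\<^esub> \<phi> p) \<in> T \<rightarrow> carrier N"
    if "\<phi> \<in> carrier (free_rmodule R S)" "T \<subseteq> S" for \<phi> T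
    using that a by (auto simp: free_rmodule_def image_subset_iff Pi_iff subset_iff)
  have supp: "finite {p. \<phi> p \<noteq> \<zero>\<^bsub>R\<^esub>}" "{p. \<phi> p \<noteq> \<zero>\<^bsub>R\<^esub>} \<subseteq> S"
    if "\<phi> \<in> carrier (free_rmodule R S)" for \<phi>
    using that by (auto simp: free_rmodule_def)
  have vals: "\<phi> p \<in> carrier R" if "\<phi> \<in> carrier (free_rmodule R S)" for \<phi> p
    using that by (auto simp: free_rmodule_def image_subset_iff)
  show ?thesis unfolding rmodule_hom_def mem_Collect_eq
  proof (intro conjI ballI)
    show "free_ext R N a \<in> carrier (free_rmodule R S) \<rightarrow> carrier N"
      unfolding free_ext_def by (intro Pi_I N.M.finsum_closed cl supp)
  next
    fix \<phi> \<psi> assume A: "\<phi> \<in> carrier (free_rmodule R S)" "\<psi> \<in> carrier (free_rmodule R S)"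
    let ?T = "{p. \<phi> p \<noteq> \<zero>\<^bsub>R\<^esub>} \<union> {p. \<psi> p \<noteq> \<zero>\<^bsub>R\<^esub>}"
    have T: "finite ?T" "?T \<subseteq> S" using supp A by auto
    have s: "\<phi> \<oplus>\<^bsub>free_rmodule R S\<^esub> \<psi> = (\<lambda>p. \<phi> p \<oplus>\<^bsub>R\<^esub> \<psi> p)" by (simp add: free_rmodule_def)
    have "{p. (\<phi> \<oplus>\<^bsub>free_rmodule R S\<^esub> \<psi>) p \<noteq> \<zero>\<^bsub>R\<^esub>} \<subseteq> ?T" unfolding s by auto
    then have "free_ext R N a (\<phi> \<oplus>\<^bsub>free_rmodule R S\<^esub> \<psi>)
        = finsum N (\<lambda>p. a p \<cdot>\<^bsub>N\<^esub> (\<phi> p \<oplus>\<^bsub>R\<^esub> \<psi> p)) ?T"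
      using free_ext_superset[OF N a F.M.a_closed[OF A] T(1) _ T(2)] s by simp
    also have "\<dots> = finsum N (\<lambda>p. a p \<cdot>\<^bsub>N\<^esub> \<phi> p \<oplus>\<^bsub>N\<^esub> a p \<cdot>\<^bsub>N\<^esub> \<psi> p) ?T"
      using a T(2) vals A cl[OF A(1) T(2)] cl[OF A(2) T(2)]
      by (intro N.M.finsum_cong' N.rsmult_r_distr) (auto simp del: Un_iff)
    also have "\<dots> = finsum N (\<lambda>p. a p \<cdot>\<^bsub>N\<^esub> \<phi> p) ?T \<oplus>\<^bsub>N\<^esub> finsum N (\<lambda>p. a p \<cdot>\<^bsub>N\<^esub> \<psi> p) ?T"
      by (intro N.M.finsum_addf cl A T)
    finally show "free_ext R N a (\<phi> \<oplus>\<^bsub>free_rmodule R S\<^esub> \<psi>) = free_ext R N a \<phi> \<oplus>\<^bsub>N\<^esub> free_ext R N a \<psi>"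
      using free_ext_superset[OF N a A(1) T(1) _ T(2)] free_ext_superset[OF N a A(2) T(1) _ T(2)]
      by simp
  next
    fix \<phi> r assume A: "\<phi> \<in> carrier (free_rmodule R S)" "r \<in> carrier R"
    let ?T = "{p. \<phi> p \<noteq> \<zero>\<^bsub>R\<^esub>}"
    have T: "finite ?T" "?T \<subseteq> S" using supp A by auto
    have s: "\<phi> \<cdot>\<^bsub>free_rmodule R S\<^esub> r = (\<lambda>p. \<phi> p \<otimes>\<^bsub>R\<^esub> r)" by (simp add: free_rmodule_def)
    have "{p. (\<phi> \<cdot>\<^bsub>free_rmodule R S\<^esub> r) p \<noteq> \<zero>\<^bsub>R\<^esub>} \<subseteq> ?T" unfolding s using A by auto
    then have 1: "free_ext R N a (\<phi> \<cdot>\<^bsub>free_rmodule R S\<^esub> r)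
        = finsum N (\<lambda>p. a p \<cdot>\<^bsub>N\<^esub> (\<phi> p \<otimes>\<^bsub>R\<^esub> r)) ?T"
      using free_ext_superset[OF N a F.rsmult_closed[OF A] T(1) _ T(2)] s by simp
    have 2: "finsum N b U \<cdot>\<^bsub>N\<^esub> r = finsum N (\<lambda>p. b p \<cdot>\<^bsub>N\<^esub> r) U"
      if "finite U" "b \<in> U \<rightarrow> carrier N" for b U using that
      by (induction U rule: finite_induct)
        (use A in \<open>auto simp: N.rsmult_l_distr N.M.finsum_closed Pi_iff\<close>)
    have 3: "finsum N (\<lambda>p. a p \<cdot>\<^bsub>N\<^esub> (\<phi> p \<otimes>\<^bsub>R\<^esub> r)) ?T
        = finsum N (\<lambda>p. a p \<cdot>\<^bsub>N\<^esub> \<phi> p \<cdot>\<^bsub>N\<^esub> r) ?T"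
      using a T(2) vals A cl[OF A(1) T(2)]
      by (intro N.M.finsum_cong' N.rsmult_assoc) (auto simp: Pi_iff)
    show "free_ext R N a (\<phi> \<cdot>\<^bsub>free_rmodule R S\<^esub> r) = free_ext R N a \<phi> \<cdot>\<^bsub>N\<^esub> r"
      unfolding 1 3 unfolding free_ext_def
      using 2[OF T(1) cl[OF A(1) T(2)]] by simp
  qed
qed

lemma free_ext_surj:
  assumes M: "right_module R M" and a: "a \<in> S \<rightarrow> carrier M" and s: "s \<in> S"
  shows "\<exists>\<phi>\<in>carrier (free_rmodule R S). free_ext R M a \<phi> = a s"
proof
  interpret M: right_module R M by (fact M)
  let ?\<phi> = "\<lambda>p. if p = s then \<one>\<^bsub>R\<^esub> else \<zero>\<^bsub>R\<^esub>"
  show c: "?\<phi> \<in> carrier (free_rmodule R S)"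
    using s by (auto simp: free_rmodule_def intro: finite_subset[of _ "{s}"])
  have "free_ext R M a ?\<phi> = finsum M (\<lambda>p. a p \<cdot>\<^bsub>M\<^esub> ?\<phi> p) {s}"
    using s by (intro free_ext_superset[OF M a c]) auto
  also have "\<dots> = a s" using a s by (simp add: Pi_iff)
  finally show "free_ext R M a ?\<phi> = a s" .
qed

lemma projective_rmodule_section:
  fixes R :: "('r, 'x) ring_scheme" and M :: "('r, 'm) rmodule"
  assumes P: "projective_rmodule R M"
  obtains h where "h \<in> rmodule_hom R M (free_rmodule R (carrier M))"
    and "\<And>x. x \<in> carrier M \<Longrightarrow> free_ext R M (\<lambda>x. x) (h x) = x"
proof -
  let ?F = "free_rmodule R (carrier M)"
  have M: "right_module R M" using P by (simp add: projective_rmodule_def)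
  then interpret M: right_module R M .
  have a: "(\<lambda>x. x) \<in> carrier M \<rightarrow> carrier M" by simp
  have "free_ext R M (\<lambda>x. x) ` carrier ?F = carrier M"
    using free_ext_hom[OF M a] free_ext_surj[OF M a]
    unfolding rmodule_hom_def by (fastforce simp: image_iff)
  with free_ext_hom[OF M a] have g: "free_ext R M (\<lambda>x. x) \<in> rmodule_epi R ?F M"
    unfolding rmodule_epi_def by simp
  have i: "(\<lambda>x. x) \<in> rmodule_hom R M M" by (simp add: rmodule_hom_def)
  from P free_rmodule_right_module[OF M.R.ring_axioms] M g i that show ?thesis
    unfolding projective_rmodule_def by meson
qed

lemma rmodule_hom_comp:
  "\<lbrakk>f \<in> rmodule_hom R A B; g \<in> rmodule_hom R B C\<rbrakk> \<Longrightarrow> (\<lambda>x. g (f x)) \<in> rmodule_hom R A C"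
  unfolding rmodule_hom_def by (auto simp: Pi_iff)

lemma projective_rmodule_lift:
  fixes M :: "('r, 'm) rmodule" and A :: "('r, 'a) rmodule" and B :: "('r, 'b) rmodule"
  assumes P: "projective_rmodule R M" and A: "right_module R A" and B: "right_module R B"
    and g: "g \<in> rmodule_epi R A B" and f: "f \<in> rmodule_hom R M B"
  shows "\<exists>h\<in>rmodule_hom R M A. \<forall>x\<in>carrier M. g (h x) = f x"
proof -
  let ?F = "free_rmodule R (carrier M)"
  have M: "right_module R M" using P by (simp add: projective_rmodule_def)
  interpret M: right_module R M by (fact M)
  interpret A: right_module R A by (fact A)
  obtain h where h: "h \<in> rmodule_hom R M ?F"
    and hid: "\<And>x. x \<in> carrier M \<Longrightarrow> free_ext R M (\<lambda>x. x) (h x) = x"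
    using projective_rmodule_section[OF P] by blast
  have gh: "g \<in> rmodule_hom R A B" using g by (simp add: rmodule_epi_def)
  have "\<forall>x\<in>carrier M. \<exists>y. y \<in> carrier A \<and> g y = f x"
  proof
    fix x assume "x \<in> carrier M"
    then have "f x \<in> g ` carrier A" using f g unfolding rmodule_hom_def rmodule_epi_def by auto
    then show "\<exists>y. y \<in> carrier A \<and> g y = f x" by auto
  qed
  then obtain a where aA: "\<And>x. x \<in> carrier M \<Longrightarrow> a x \<in> carrier A"
    and ag: "\<And>x. x \<in> carrier M \<Longrightarrow> g (a x) = f x" by metis
  then have a: "a \<in> carrier M \<rightarrow> carrier A" by simp
  have key: "g (free_ext R A a \<phi>) = f (free_ext R M (\<lambda>x. x) \<phi>)" if phi: "\<phi> \<in> carrier ?F" for \<phi>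
  proof -
    let ?T = "{p. \<phi> p \<noteq> \<zero>\<^bsub>R\<^esub>}"
    have T: "finite ?T" "?T \<subseteq> carrier M" using phi by (auto simp: free_rmodule_def)
    have v: "\<phi> p \<in> carrier R" for p using phi by (auto simp: free_rmodule_def image_subset_iff)
    have "g (free_ext R A a \<phi>) = finsum B (\<lambda>p. g (a p \<cdot>\<^bsub>A\<^esub> \<phi> p)) ?T"
      unfolding free_ext_def using T v aA
      by (intro rmodule_hom_finsum[OF A B gh]) (auto simp: subset_iff)
    moreover have "f (free_ext R M (\<lambda>x. x) \<phi>) = finsum B (\<lambda>p. f (p \<cdot>\<^bsub>M\<^esub> \<phi> p)) ?T"
      unfolding free_ext_def using T v
      by (intro rmodule_hom_finsum[OF M B f]) (auto simp: subset_iff)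
    moreover have "finsum B (\<lambda>p. g (a p \<cdot>\<^bsub>A\<^esub> \<phi> p)) ?T = finsum B (\<lambda>p. f (p \<cdot>\<^bsub>M\<^esub> \<phi> p)) ?T"
    proof -
      interpret B: right_module R B by (fact B)
      have "g (a p \<cdot>\<^bsub>A\<^esub> \<phi> p) = f (p \<cdot>\<^bsub>M\<^esub> \<phi> p)" if "p \<in> ?T" for p
      proof -
        have p: "p \<in> carrier M" using that T by auto
        have "g (a p \<cdot>\<^bsub>A\<^esub> \<phi> p) = g (a p) \<cdot>\<^bsub>B\<^esub> \<phi> p"
          using gh aA[OF p] v unfolding rmodule_hom_def by blast
        moreover have "f (p \<cdot>\<^bsub>M\<^esub> \<phi> p) = f p \<cdot>\<^bsub>B\<^esub> \<phi> p"
          using f p v unfolding rmodule_hom_def by blast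
        ultimately show ?thesis using ag[OF p] by simp
      qed
      moreover have "f (p \<cdot>\<^bsub>M\<^esub> \<phi> p) \<in> carrier B" if "p \<in> ?T" for p
        using f T v that unfolding rmodule_hom_def by blast
      ultimately show ?thesis by (intro B.M.finsum_cong') auto
    qed
    ultimately show ?thesis by simp
  qed
  show ?thesis
  proof (intro bexI ballI)
    show "(\<lambda>x. free_ext R A a (h x)) \<in> rmodule_hom R M A"
      using rmodule_hom_comp[OF h free_ext_hom[OF A a]] .
    show "g (free_ext R A a (h x)) = f x" if x: "x \<in> carrier M" for x
    proof -
      have "h x \<in> carrier ?F" using h x unfolding rmodule_hom_def by blast
      then show ?thesis using key hid[OF x] by simp
    qed
  qed
qed


subsection \<open>Projective \<open>\<delta>\<close>-covers on arbitrary types\<close>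

lemma rsubmoduleD:
  assumes "right_module R M" and "rsubmodule R M N"
  shows "N \<subseteq> carrier M" and "\<zero>\<^bsub>M\<^esub> \<in> N"
    and "\<lbrakk>x \<in> N; y \<in> N\<rbrakk> \<Longrightarrow> x \<oplus>\<^bsub>M\<^esub> y \<in> N"
    and "x \<in> N \<Longrightarrow> \<ominus>\<^bsub>M\<^esub> x \<in> N"
    and "\<lbrakk>x \<in> N; r \<in> carrier R\<rbrakk> \<Longrightarrow> x \<cdot>\<^bsub>M\<^esub> r \<in> N"
proof -
  interpret M: right_module R M by (fact assms)
  interpret N: additive_subgroup N M using assms by (simp add: rsubmodule_def)
  show "N \<subseteq> carrier M" "\<zero>\<^bsub>M\<^esub> \<in> N" "\<lbrakk>x \<in> N; y \<in> N\<rbrakk> \<Longrightarrow> x \<oplus>\<^bsub>M\<^esub> y \<in> N"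
    "x \<in> N \<Longrightarrow> \<ominus>\<^bsub>M\<^esub> x \<in> N"
    using N.a_subset N.a_inv_closed M.M.abelian_group_axioms by auto
  show "\<lbrakk>x \<in> N; r \<in> carrier R\<rbrakk> \<Longrightarrow> x \<cdot>\<^bsub>M\<^esub> r \<in> N"
    using assms by (simp add: rsubmodule_def)
qed

lemma rsubmoduleI:
  assumes M: "right_module R M" and sub: "N \<subseteq> carrier M" and z: "\<zero>\<^bsub>M\<^esub> \<in> N"
    and add: "\<And>x y. \<lbrakk>x \<in> N; y \<in> N\<rbrakk> \<Longrightarrow> x \<oplus>\<^bsub>M\<^esub> y \<in> N"
    and sm: "\<And>x r. \<lbrakk>x \<in> N; r \<in> carrier R\<rbrakk> \<Longrightarrow> x \<cdot>\<^bsub>M\<^esub> r \<in> N"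
  shows "rsubmodule R M N"
proof -
  interpret M: right_module R M by (fact M)
  have inv: "\<ominus>\<^bsub>M\<^esub> x \<in> N" if x: "x \<in> N" for x
  proof -
    have xc: "x \<in> carrier M" using x sub by auto
    have "x \<cdot>\<^bsub>M\<^esub> (\<ominus>\<^bsub>R\<^esub> \<one>\<^bsub>R\<^esub>) \<oplus>\<^bsub>M\<^esub> x = x \<cdot>\<^bsub>M\<^esub> (\<ominus>\<^bsub>R\<^esub> \<one>\<^bsub>R\<^esub> \<oplus>\<^bsub>R\<^esub> \<one>\<^bsub>R\<^esub>)"
      using M.rsmult_r_distr[OF xc, of "\<ominus>\<^bsub>R\<^esub> \<one>\<^bsub>R\<^esub>" "\<one>\<^bsub>R\<^esub>"] xc by simp
    also have "\<dots> = \<zero>\<^bsub>M\<^esub>" using xc by (simp add: M.R.l_neg)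
    finally have "x \<cdot>\<^bsub>M\<^esub> (\<ominus>\<^bsub>R\<^esub> \<one>\<^bsub>R\<^esub>) = \<ominus>\<^bsub>M\<^esub> x"
      using xc by (intro M.M.minus_equality[symmetric]) auto
    with sm[OF x, of "\<ominus>\<^bsub>R\<^esub> \<one>\<^bsub>R\<^esub>"] show ?thesis by simp
  qed
  have "subgroup N (add_monoid M)"
    using sub z add inv by (intro M.M.add.subgroupI) auto
  then show ?thesis using sm by (simp add: rsubmodule_def additive_subgroup_def)
qed

lemma rsubmodule_right_module:
  fixes M :: "('r, 'm) rmodule"
  assumes M: "right_module R M" and N: "rsubmodule R M N"
  shows "right_module R (M\<lparr>carrier := N\<rparr>)"
proof -
  interpret M: right_module R M by (fact M)
  note D = rsubmoduleD[OF M N]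
  have "abelian_group (M\<lparr>carrier := N\<rparr>)"
  proof (rule abelian_groupI)
    fix x assume x: "x \<in> carrier (M\<lparr>carrier := N\<rparr>)"
    then show "\<exists>y\<in>carrier (M\<lparr>carrier := N\<rparr>). y \<oplus>\<^bsub>M\<lparr>carrier := N\<rparr>\<^esub> x = \<zero>\<^bsub>M\<lparr>carrier := N\<rparr>\<^esub>"
      using D(1,4) by (intro bexI[of _ "\<ominus>\<^bsub>M\<^esub> x"]) (auto simp: M.M.l_neg subset_iff)
  qed (use D in \<open>auto simp: subset_iff M.M.a_ac\<close>)
  then show ?thesis using D M.R.ring_axioms
    by (intro right_module.intro right_module_axioms.intro)
      (auto simp: subset_iff M.rsmult_l_distr M.rsmult_r_distr M.rsmult_assoc)
qed

lemma regular_right_module: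
  assumes "ring R" shows "right_module R (regular_rmodule R)"
proof -
  interpret R: ring R by (fact assms)
  have "abelian_group (regular_rmodule R)"
    by (rule abelian_groupI)
      (auto simp: regular_rmodule_def R.a_ac intro: bexI[of _ "\<ominus>\<^bsub>R\<^esub> _"] R.l_neg)
  then show ?thesis using assms
    by (intro right_module.intro right_module_axioms.intro)
      (auto simp: regular_rmodule_def R.l_distr R.r_distr R.m_assoc)
qed

lemma rmodule_homD:
  assumes "f \<in> rmodule_hom R M N"
  shows "x \<in> carrier M \<Longrightarrow> f x \<in> carrier N"
    and "\<lbrakk>x \<in> carrier M; y \<in> carrier M\<rbrakk> \<Longrightarrow> f (x \<oplus>\<^bsub>M\<^esub> y) = f x \<oplus>\<^bsub>N\<^esub> f y"
    and "\<lbrakk>x \<in> carrier M; r \<in> carrier R\<rbrakk> \<Longrightarrow> f (x \<cdot>\<^bsub>M\<^esub> r) = f x \<cdot>\<^bsub>N\<^esub> r"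
  using assms unfolding rmodule_hom_def by auto

lemma rmodule_hom_zero:
  assumes "right_module R M" "right_module R N" "f \<in> rmodule_hom R M N"
  shows "f \<zero>\<^bsub>M\<^esub> = \<zero>\<^bsub>N\<^esub>"
proof -
  interpret M: right_module R M by (fact assms)
  interpret N: right_module R N by (fact assms)
  show ?thesis
    using rmodule_homD(3)[OF assms(3), of "\<zero>\<^bsub>M\<^esub>" "\<zero>\<^bsub>R\<^esub>"] rmodule_homD(1)[OF assms(3), of "\<zero>\<^bsub>M\<^esub>"]
    by simp
qed

lemma rmodule_hom_image:
  assumes "right_module R M" "right_module R N" "f \<in> rmodule_hom R M N" "rsubmodule R M X"
  shows "rsubmodule R N (f ` X)"
proof -
  note D = rsubmoduleD[OF assms(1,4)]
  note h = rmodule_homD[OF assms(3)]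
  show ?thesis
  proof (rule rsubmoduleI[OF assms(2)])
    show "f ` X \<subseteq> carrier N" using D(1) h(1) by auto
    show "\<zero>\<^bsub>N\<^esub> \<in> f ` X" using D(2) rmodule_hom_zero[OF assms(1-3)] by (metis imageI)
    fix x y assume "x \<in> f ` X" "y \<in> f ` X"
    then obtain a b where "a \<in> X" "b \<in> X" "x = f a" "y = f b" by auto
    then have "x \<oplus>\<^bsub>N\<^esub> y = f (a \<oplus>\<^bsub>M\<^esub> b)" "a \<oplus>\<^bsub>M\<^esub> b \<in> X" using D h(2) by (auto simp: subset_iff)
    then show "x \<oplus>\<^bsub>N\<^esub> y \<in> f ` X" by blast
  next
    fix x r assume "x \<in> f ` X" "r \<in> carrier R"
    then obtain a where "a \<in> X" "x = f a" by auto
    then have "x \<cdot>\<^bsub>N\<^esub> r = f (a \<cdot>\<^bsub>M\<^esub> r)" "a \<cdot>\<^bsub>M\<^esub> r \<in> X"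
      using D h(3) \<open>r \<in> carrier R\<close> by (auto simp: subset_iff)
    then show "x \<cdot>\<^bsub>N\<^esub> r \<in> f ` X" by blast
  qed
qed

lemma rmodule_hom_vimage:
  assumes "right_module R M" "right_module R N" "f \<in> rmodule_hom R M N" "rsubmodule R N Z"
  shows "rsubmodule R M {x \<in> carrier M. f x \<in> Z}"
proof -
  interpret M: right_module R M by (fact assms)
  note D = rsubmoduleD[OF assms(2,4)]
  note h = rmodule_homD[OF assms(3)]
  show ?thesis
    using D h rmodule_hom_zero[OF assms(1-3)] by (intro rsubmoduleI[OF assms(1)]) auto
qed

lemma carrier_rsubmodule: "right_module R M \<Longrightarrow> rsubmodule R M (carrier M)"
proof -
  assume M: "right_module R M"
  interpret M: right_module R M by (fact M)
  show ?thesis by (rule rsubmoduleI[OF M]) auto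
qed

lemma a_r_coset_rsubmodule_eq_iff:
  assumes M: "right_module R M" and N: "rsubmodule R M N" and "x \<in> carrier M"
  shows "N +>\<^bsub>M\<^esub> x = N \<longleftrightarrow> x \<in> N"
proof -
  interpret M: right_module R M by (fact M)
  have "subgroup N (add_monoid M)"
    using N by (simp add: rsubmodule_def additive_subgroup_def)
  then show ?thesis using M.M.a_coset_join1 M.M.a_coset_join2 assms(3) by blast
qed

lemma factor_rmodule_rsmult:
  fixes M :: "('r, 'm) rmodule"
  assumes M: "right_module R M" and N: "rsubmodule R M N" and x: "x \<in> carrier M"
    and r: "r \<in> carrier R"
  shows "(N +>\<^bsub>M\<^esub> x) \<cdot>\<^bsub>factor_rmodule M N\<^esub> r = N +>\<^bsub>M\<^esub> (x \<cdot>\<^bsub>M\<^esub> r)"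
proof -
  interpret M: right_module R M by (fact M)
  note D = rsubmoduleD[OF M N]
  have eq: "N +>\<^bsub>M\<^esub> (n \<oplus>\<^bsub>M\<^esub> x) \<cdot>\<^bsub>M\<^esub> r = N +>\<^bsub>M\<^esub> x \<cdot>\<^bsub>M\<^esub> r" if n: "n \<in> N" for n
  proof -
    have nc: "n \<in> carrier M" "n \<cdot>\<^bsub>M\<^esub> r \<in> N" using n D r by auto
    then have "N +>\<^bsub>M\<^esub> (n \<oplus>\<^bsub>M\<^esub> x) \<cdot>\<^bsub>M\<^esub> r = (N +>\<^bsub>M\<^esub> n \<cdot>\<^bsub>M\<^esub> r) +>\<^bsub>M\<^esub> x \<cdot>\<^bsub>M\<^esub> r"
      using x r D(1) by (simp add: M.rsmult_l_distr M.M.a_coset_add_assoc)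
    also have "N +>\<^bsub>M\<^esub> n \<cdot>\<^bsub>M\<^esub> r = N"
      using a_r_coset_rsubmodule_eq_iff[OF M N] nc r by simp
    finally show ?thesis .
  qed
  have "(N +>\<^bsub>M\<^esub> x) \<cdot>\<^bsub>factor_rmodule M N\<^esub> r = (\<Union>n\<in>N. N +>\<^bsub>M\<^esub> (n \<oplus>\<^bsub>M\<^esub> x) \<cdot>\<^bsub>M\<^esub> r)"
    by (simp add: factor_rmodule_def a_r_coset_def'[of M N x])
  then show ?thesis using eq D(2) by auto
qed

lemma factor_rmodule_add:
  fixes M :: "('r, 'm) rmodule"
  assumes M: "right_module R M" and N: "rsubmodule R M N" and "x \<in> carrier M" "y \<in> carrier M"
  shows "(N +>\<^bsub>M\<^esub> x) \<oplus>\<^bsub>factor_rmodule M N\<^esub> (N +>\<^bsub>M\<^esub> y) = N +>\<^bsub>M\<^esub> (x \<oplus>\<^bsub>M\<^esub> y)"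
proof -
  interpret M: right_module R M by (fact M)
  have "abelian_subgroup N M"
    using N M.M.abelian_group_axioms by (simp add: rsubmodule_def abelian_subgroupI3)
  then show ?thesis using assms(3,4)
    by (simp add: factor_rmodule_def abelian_subgroup.a_rcos_sum)
qed

lemma factor_rmodule_right_module:
  fixes M :: "('r, 'm) rmodule"
  assumes M: "right_module R M" and N: "rsubmodule R M N"
  shows "right_module R (factor_rmodule M N)"
proof -
  interpret M: right_module R M by (fact M)
  let ?Q = "factor_rmodule M N"
  have c: "carrier ?Q = (\<lambda>x. N +>\<^bsub>M\<^esub> x) ` carrier M"
    by (auto simp: factor_rmodule_def A_RCOSETS_def')
  have z: "\<zero>\<^bsub>?Q\<^esub> = N +>\<^bsub>M\<^esub> \<zero>\<^bsub>M\<^esub>"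
    using rsubmoduleD(1)[OF M N] by (simp add: factor_rmodule_def)
  note add = factor_rmodule_add[OF M N]
  note smult = factor_rmodule_rsmult[OF M N]
  have "abelian_group ?Q"
  proof (rule abelian_groupI)
    fix C assume "C \<in> carrier ?Q"
    then obtain x where x: "x \<in> carrier M" "C = N +>\<^bsub>M\<^esub> x" using c by auto
    then have "(N +>\<^bsub>M\<^esub> (\<ominus>\<^bsub>M\<^esub> x)) \<oplus>\<^bsub>?Q\<^esub> C = \<zero>\<^bsub>?Q\<^esub>" by (simp add: add z M.M.l_neg)
    moreover have "N +>\<^bsub>M\<^esub> (\<ominus>\<^bsub>M\<^esub> x) \<in> carrier ?Q" using x c by auto
    ultimately show "\<exists>D\<in>carrier ?Q. D \<oplus>\<^bsub>?Q\<^esub> C = \<zero>\<^bsub>?Q\<^esub>" by blast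
  qed (auto simp: c z add M.M.a_ac)
  then show ?thesis using M.R.ring_axioms
    by (intro right_module.intro right_module_axioms.intro)
      (auto simp: c add smult M.rsmult_l_distr M.rsmult_r_distr M.rsmult_assoc)
qed

lemma cyclic_rsubmodule_rsubmodule:
  fixes M :: "('r, 'm) rmodule"
  assumes M: "right_module R M" and m: "m \<in> carrier M"
  shows "rsubmodule R M (cyclic_rsubmodule R M m)"
proof -
  interpret M: right_module R M by (fact M)
  have RR: "right_module R (regular_rmodule R)"
    by (rule regular_right_module) (rule M.R.ring_axioms)
  have h: "(\<lambda>r. m \<cdot>\<^bsub>M\<^esub> r) \<in> rmodule_hom R (regular_rmodule R) M"
    using m by (auto simp: rmodule_hom_def regular_rmodule_def M.rsmult_r_distr M.rsmult_assoc)
  have "cyclic_rsubmodule R M m = (\<lambda>r. m \<cdot>\<^bsub>M\<^esub> r) ` carrier (regular_rmodule R)"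
    by (auto simp: cyclic_rsubmodule_def regular_rmodule_def)
  then show ?thesis
    using rmodule_hom_image[OF RR M h carrier_rsubmodule[OF RR]] by simp
qed

lemma singular_factor_rmodule_iff:
  fixes M :: "('r, 'm) rmodule"
  assumes M: "right_module R M" and N: "rsubmodule R M N"
  shows "singular_rmodule R (factor_rmodule M N) \<longleftrightarrow>
    (\<forall>x\<in>carrier M. essential_rsubmodule R (regular_rmodule R) {r \<in> carrier R. x \<cdot>\<^bsub>M\<^esub> r \<in> N})"
proof -
  interpret M: right_module R M by (fact M)
  have c: "carrier (factor_rmodule M N) = (\<lambda>x. N +>\<^bsub>M\<^esub> x) ` carrier M"
    by (auto simp: factor_rmodule_def A_RCOSETS_def')
  have "r_annihilator R (factor_rmodule M N) (N +>\<^bsub>M\<^esub> x) = {r \<in> carrier R. x \<cdot>\<^bsub>M\<^esub> r \<in> N}"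
    if "x \<in> carrier M" for x
  proof -
    have "\<zero>\<^bsub>factor_rmodule M N\<^esub> = N" by (simp add: factor_rmodule_def)
    then show ?thesis
      using factor_rmodule_rsmult[OF M N that] a_r_coset_rsubmodule_eq_iff[OF M N] that
      unfolding r_annihilator_def by (intro Collect_cong) (simp cong: conj_cong)
  qed
  moreover have "singular_rmodule R (factor_rmodule M N) \<longleftrightarrow>
      (\<forall>x\<in>carrier M. essential_rsubmodule R (regular_rmodule R)
         (r_annihilator R (factor_rmodule M N) (N +>\<^bsub>M\<^esub> x)))"
    unfolding singular_rmodule_def singular_rsubmodule_def c by blast
  ultimately show ?thesis by simp
qed

lemma delta_small_image:
  fixes P :: "('r, 'p) rmodule" and Q :: "('r, 'q) rmodule"
  assumes P: "right_module R P" and Q: "right_module R Q" and \<rho>: "\<rho> \<in> rmodule_epi R P Q"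
    and K: "delta_small R P K" and N: "rsubmodule R Q N" "N \<subseteq> \<rho> ` K"
  shows "delta_small R Q N"
  unfolding delta_small_def
proof (intro conjI allI impI)
  show "rsubmodule R Q N" by (fact N)
  interpret P: right_module R P by (fact P)
  interpret Q: right_module R Q by (fact Q)
  have hom: "\<rho> \<in> rmodule_hom R P Q" and surj: "\<rho> ` carrier P = carrier Q"
    using \<rho> by (auto simp: rmodule_epi_def)
  note h = rmodule_homD[OF hom]
  have Ks: "rsubmodule R P K" using K by (simp add: delta_small_def)
  note KD = rsubmoduleD[OF P Ks]
  fix Z assume Z: "rsubmodule R Q Z \<and> carrier Q = N <+>\<^bsub>Q\<^esub> Z \<and> singular_rmodule R (factor_rmodule Q Z)"
  then have Zs: "rsubmodule R Q Z" by simp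
  let ?W = "{x \<in> carrier P. \<rho> x \<in> Z}"
  have W: "rsubmodule R P ?W" by (rule rmodule_hom_vimage[OF P Q hom Zs])
  have "carrier P \<subseteq> K <+>\<^bsub>P\<^esub> ?W"
  proof
    fix p assume p: "p \<in> carrier P"
    then have "\<rho> p \<in> N <+>\<^bsub>Q\<^esub> Z" using Z h(1) by blast
    then obtain n z where nz: "n \<in> N" "z \<in> Z" "\<rho> p = n \<oplus>\<^bsub>Q\<^esub> z" by (auto simp: set_add_def')
    then obtain k where k: "k \<in> K" "n = \<rho> k" using N by auto
    have kc: "k \<in> carrier P" and zc: "z \<in> carrier Q" and mk: "\<ominus>\<^bsub>P\<^esub> k \<in> carrier P"
      using k KD nz rsubmoduleD[OF Q Zs] by auto
    let ?w = "\<ominus>\<^bsub>P\<^esub> k \<oplus>\<^bsub>P\<^esub> p"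
    have "\<rho> ?w = \<rho> (\<ominus>\<^bsub>P\<^esub> k) \<oplus>\<^bsub>Q\<^esub> (\<rho> k \<oplus>\<^bsub>Q\<^esub> z)" using h(2)[OF mk p] nz k by simp
    also have "\<dots> = \<rho> (\<ominus>\<^bsub>P\<^esub> k \<oplus>\<^bsub>P\<^esub> k) \<oplus>\<^bsub>Q\<^esub> z"
      using h(1,2) kc mk zc by (simp add: Q.M.a_assoc)
    also have "\<dots> = z" using kc zc rmodule_hom_zero[OF P Q hom] by (simp add: P.M.l_neg)
    finally have "?w \<in> ?W" using nz mk p by simp
    moreover have "p = k \<oplus>\<^bsub>P\<^esub> ?w" using kc p by (simp add: P.M.r_neg2)
    ultimately show "p \<in> K <+>\<^bsub>P\<^esub> ?W" using k(1) unfolding set_add_def' by blast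
  qed
  moreover have "K <+>\<^bsub>P\<^esub> ?W \<subseteq> carrier P" using KD(1) by (auto simp: set_add_def')
  ultimately have sum: "carrier P = K <+>\<^bsub>P\<^esub> ?W" by auto
  have "singular_rmodule R (factor_rmodule P ?W)"
    unfolding singular_factor_rmodule_iff[OF P W]
  proof
    fix x assume x: "x \<in> carrier P"
    have "{r \<in> carrier R. x \<cdot>\<^bsub>P\<^esub> r \<in> ?W} = {r \<in> carrier R. \<rho> x \<cdot>\<^bsub>Q\<^esub> r \<in> Z}"
      using x h(3) by auto
    then show "essential_rsubmodule R (regular_rmodule R) {r \<in> carrier R. x \<cdot>\<^bsub>P\<^esub> r \<in> ?W}"
      using Z singular_factor_rmodule_iff[OF Q Zs] h(1)[OF x] by simp
  qed
  then have "carrier P = ?W" using K W sum unfolding delta_small_def by blast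
  then have "\<rho> x \<in> Z" if "x \<in> carrier P" for x using that by blast
  then have "carrier Q \<subseteq> Z" unfolding surj[symmetric] by blast
  then show "carrier Q = Z" using rsubmoduleD(1)[OF Q Zs] by auto
qed

lemma rsubmodule_sum:
  assumes M: "right_module R M" and X: "rsubmodule R M X" and Y: "rsubmodule R M Y"
  shows "rsubmodule R M (X <+>\<^bsub>M\<^esub> Y)"
proof -
  interpret M: right_module R M by (fact M)
  note XD = rsubmoduleD[OF M X]
  note YD = rsubmoduleD[OF M Y]
  show ?thesis
  proof (rule rsubmoduleI[OF M])
    show "X <+>\<^bsub>M\<^esub> Y \<subseteq> carrier M" using XD(1) YD(1) by (auto simp: set_add_def')
    show "\<zero>\<^bsub>M\<^esub> \<in> X <+>\<^bsub>M\<^esub> Y" using XD(2) YD(2) unfolding set_add_def' by force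
    fix a b assume "a \<in> X <+>\<^bsub>M\<^esub> Y" "b \<in> X <+>\<^bsub>M\<^esub> Y"
    then obtain x y x' y' where *: "x \<in> X" "y \<in> Y" "x' \<in> X" "y' \<in> Y" "a = x \<oplus>\<^bsub>M\<^esub> y" "b = x' \<oplus>\<^bsub>M\<^esub> y'"
      by (auto simp: set_add_def')
    then have "x \<in> carrier M" "y \<in> carrier M" "x' \<in> carrier M" "y' \<in> carrier M"
      using XD YD by auto
    then have "a \<oplus>\<^bsub>M\<^esub> b = (x \<oplus>\<^bsub>M\<^esub> x') \<oplus>\<^bsub>M\<^esub> (y \<oplus>\<^bsub>M\<^esub> y')" using * by (simp add: M.M.a_ac)
    moreover have "x \<oplus>\<^bsub>M\<^esub> x' \<in> X" "y \<oplus>\<^bsub>M\<^esub> y' \<in> Y" using * XD YD by auto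
    ultimately show "a \<oplus>\<^bsub>M\<^esub> b \<in> X <+>\<^bsub>M\<^esub> Y" unfolding set_add_def' by blast
  next
    fix a r assume "a \<in> X <+>\<^bsub>M\<^esub> Y" and r: "r \<in> carrier R"
    then obtain x y where *: "x \<in> X" "y \<in> Y" "a = x \<oplus>\<^bsub>M\<^esub> y" by (auto simp: set_add_def')
    then have "a \<cdot>\<^bsub>M\<^esub> r = x \<cdot>\<^bsub>M\<^esub> r \<oplus>\<^bsub>M\<^esub> y \<cdot>\<^bsub>M\<^esub> r" using XD(1) YD(1) r M.rsmult_l_distr by blast
    moreover have "x \<cdot>\<^bsub>M\<^esub> r \<in> X" "y \<cdot>\<^bsub>M\<^esub> r \<in> Y" using * XD(5) YD(5) r by auto
    ultimately show "a \<cdot>\<^bsub>M\<^esub> r \<in> X <+>\<^bsub>M\<^esub> Y" unfolding set_add_def' by blast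
  qed
qed

lemma rsubmodule_sum_upper:
  assumes M: "right_module R M" and X: "rsubmodule R M X" and Y: "rsubmodule R M Y"
  shows "X \<subseteq> X <+>\<^bsub>M\<^esub> Y" "Y \<subseteq> X <+>\<^bsub>M\<^esub> Y"
proof -
  interpret M: right_module R M by (fact M)
  note XD = rsubmoduleD(1,2)[OF M X]
  note YD = rsubmoduleD(1,2)[OF M Y]
  have "x = x \<oplus>\<^bsub>M\<^esub> \<zero>\<^bsub>M\<^esub>" if "x \<in> X" for x using that XD(1) by auto
  then show "X \<subseteq> X <+>\<^bsub>M\<^esub> Y" using YD(2) unfolding set_add_def' by blast
  have "y = \<zero>\<^bsub>M\<^esub> \<oplus>\<^bsub>M\<^esub> y" if "y \<in> Y" for y using that YD(1) by auto
  then show "Y \<subseteq> X <+>\<^bsub>M\<^esub> Y" using XD(2) unfolding set_add_def' by blast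
qed

lemma singular_factor_essential:
  fixes M :: "('r, 'm) rmodule"
  assumes M: "right_module R M" and E: "essential_rsubmodule R M E"
  shows "singular_rmodule R (factor_rmodule M E)"
proof -
  interpret M: right_module R M by (fact M)
  let ?RR = "regular_rmodule R"
  have Es: "rsubmodule R M E" using E by (simp add: essential_rsubmodule_def)
  have RR: "right_module R ?RR" by (rule regular_right_module) (rule M.R.ring_axioms)
  have z: "\<zero>\<^bsub>?RR\<^esub> = \<zero>\<^bsub>R\<^esub>" and c: "carrier ?RR = carrier R" by (auto simp: regular_rmodule_def)
  show ?thesis unfolding singular_factor_rmodule_iff[OF M Es]
  proof
    fix x assume x: "x \<in> carrier M"
    have h: "(\<lambda>r. x \<cdot>\<^bsub>M\<^esub> r) \<in> rmodule_hom R ?RR M"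
      using x by (auto simp: rmodule_hom_def regular_rmodule_def M.rsmult_r_distr M.rsmult_assoc)
    let ?A = "{r \<in> carrier R. x \<cdot>\<^bsub>M\<^esub> r \<in> E}"
    have A: "rsubmodule R ?RR ?A" using rmodule_hom_vimage[OF RR M h Es] c by simp
    show "essential_rsubmodule R ?RR ?A" unfolding essential_rsubmodule_def
    proof (intro conjI allI impI A)
      fix I assume I: "rsubmodule R ?RR I \<and> I \<noteq> {\<zero>\<^bsub>?RR\<^esub>}"
      then have Is: "rsubmodule R ?RR I" by simp
      note ID = rsubmoduleD[OF RR Is]
      obtain i where i: "i \<in> I" "i \<noteq> \<zero>\<^bsub>R\<^esub>" using I ID(2) z by auto
      let ?J = "(\<lambda>r. x \<cdot>\<^bsub>M\<^esub> r) ` I"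
      have J: "rsubmodule R M ?J" by (rule rmodule_hom_image[OF RR M h Is])
      have "\<exists>r\<in>I. r \<in> ?A \<and> r \<noteq> \<zero>\<^bsub>R\<^esub>"
      proof (cases "?J = {\<zero>\<^bsub>M\<^esub>}")
        case True
        then have "x \<cdot>\<^bsub>M\<^esub> i = \<zero>\<^bsub>M\<^esub>" using i by auto
        then show ?thesis using i ID(1) c rsubmoduleD(2)[OF M Es] by auto
      next
        case False
        then have "E \<inter> ?J \<noteq> {\<zero>\<^bsub>M\<^esub>}" using E J by (simp add: essential_rsubmodule_def)
        moreover have "\<zero>\<^bsub>M\<^esub> \<in> E \<inter> ?J" using rsubmoduleD(2)[OF M Es] rsubmoduleD(2)[OF M J] by auto
        ultimately obtain r where r: "r \<in> I" "x \<cdot>\<^bsub>M\<^esub> r \<in> E" "x \<cdot>\<^bsub>M\<^esub> r \<noteq> \<zero>\<^bsub>M\<^esub>" by blast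
        then have "r \<noteq> \<zero>\<^bsub>R\<^esub>" using x by auto
        then show ?thesis using r ID(1) c by auto
      qed
      then show "?A \<inter> I \<noteq> {\<zero>\<^bsub>?RR\<^esub>}" using z by auto
    qed
  qed
qed

lemma delta_small_complement:
  fixes M :: "('r, 'm) rmodule"
  assumes M: "right_module R M" and K: "delta_small R M K" and X: "rsubmodule R M X"
    and KX: "carrier M = K <+>\<^bsub>M\<^esub> X"
  obtains Y where "direct_decomposition R M X Y"
proof -
  interpret M: right_module R M by (fact M)
  note XD = rsubmoduleD[OF M X]
  let ?C = "{Y. rsubmodule R M Y \<and> X \<inter> Y = {\<zero>\<^bsub>M\<^esub>}}"
  have zero: "rsubmodule R M {\<zero>\<^bsub>M\<^esub>}" by (rule rsubmoduleI[OF M]) auto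
  have "\<exists>Y\<in>?C. \<forall>Z\<in>?C. Y \<subseteq> Z \<longrightarrow> Z = Y"
  proof (rule subset_Zorn_nonempty)
    show "?C \<noteq> {}" using zero XD(2) by blast
    fix \<C> assume ne: "\<C> \<noteq> {}" and ch: "subset.chain ?C \<C>"
    have sub: "\<And>Y. Y \<in> \<C> \<Longrightarrow> rsubmodule R M Y" "\<And>Y. Y \<in> \<C> \<Longrightarrow> X \<inter> Y = {\<zero>\<^bsub>M\<^esub>}"
      using ch by (auto simp: subset_chain_def)
    have lin: "Y \<subseteq> Z \<or> Z \<subseteq> Y" if "Y \<in> \<C>" "Z \<in> \<C>" for Y Z
      using ch that by (auto simp: subset_chain_def)
    have "rsubmodule R M (\<Union>\<C>)"
    proof (rule rsubmoduleI[OF M])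
      show "\<Union>\<C> \<subseteq> carrier M" using rsubmoduleD(1)[OF M sub(1)] by auto
      show "\<zero>\<^bsub>M\<^esub> \<in> \<Union>\<C>" using rsubmoduleD(2)[OF M sub(1)] ne by auto
      fix x y assume "x \<in> \<Union>\<C>" "y \<in> \<Union>\<C>"
      then obtain Y where "Y \<in> \<C>" "x \<in> Y" "y \<in> Y" using lin by blast
      then show "x \<oplus>\<^bsub>M\<^esub> y \<in> \<Union>\<C>" using rsubmoduleD(3)[OF M sub(1)] by blast
    next
      fix x r assume "x \<in> \<Union>\<C>" "r \<in> carrier R"
      then show "x \<cdot>\<^bsub>M\<^esub> r \<in> \<Union>\<C>" using rsubmoduleD(5)[OF M sub(1)] by blast
    qed
    moreover have "X \<inter> \<Union>\<C> = {\<zero>\<^bsub>M\<^esub>}" using sub(2) ne by blast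
    ultimately show "\<Union>\<C> \<in> ?C" by simp
  qed
  then obtain Y where "Y \<in> ?C" and max': "\<forall>Z\<in>?C. Y \<subseteq> Z \<longrightarrow> Z = Y" by (rule bexE)
  then have Y: "rsubmodule R M Y" and XY: "X \<inter> Y = {\<zero>\<^bsub>M\<^esub>}" by simp_all
  have max: "Z = Y" if "rsubmodule R M Z" "X \<inter> Z = {\<zero>\<^bsub>M\<^esub>}" "Y \<subseteq> Z" for Z
    using max' that by simp
  note YD = rsubmoduleD[OF M Y]
  let ?E = "X <+>\<^bsub>M\<^esub> Y"
  have Es: "rsubmodule R M ?E" by (rule rsubmodule_sum[OF M X Y])
  have XE: "X \<subseteq> ?E" "Y \<subseteq> ?E" using rsubmodule_sum_upper[OF M X Y] by auto
  have ess: "essential_rsubmodule R M ?E" unfolding essential_rsubmodule_def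
  proof (intro conjI allI impI Es notI)
    fix Z assume Z: "rsubmodule R M Z \<and> Z \<noteq> {\<zero>\<^bsub>M\<^esub>}" and EZ: "?E \<inter> Z = {\<zero>\<^bsub>M\<^esub>}"
    then have Zs: "rsubmodule R M Z" by simp
    note ZD = rsubmoduleD[OF M Zs]
    have "X \<inter> (Y <+>\<^bsub>M\<^esub> Z) \<subseteq> {\<zero>\<^bsub>M\<^esub>}"
    proof
      fix a assume "a \<in> X \<inter> (Y <+>\<^bsub>M\<^esub> Z)"
      then obtain y z where a: "a \<in> X" "y \<in> Y" "z \<in> Z" "a = y \<oplus>\<^bsub>M\<^esub> z" by (auto simp: set_add_def')
      have cc: "y \<in> carrier M" "z \<in> carrier M" using a YD ZD by auto
      then have "z = a \<oplus>\<^bsub>M\<^esub> \<ominus>\<^bsub>M\<^esub> y" using a(4) by (simp add: M.M.a_comm[of y z] M.M.a_assoc M.M.r_neg)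
      moreover have "\<dots> \<in> ?E" using a YD(4) unfolding set_add_def' by blast
      ultimately have "z = \<zero>\<^bsub>M\<^esub>" using EZ a by auto
      then show "a \<in> {\<zero>\<^bsub>M\<^esub>}" using a cc XY by auto
    qed
    then have "X \<inter> (Y <+>\<^bsub>M\<^esub> Z) = {\<zero>\<^bsub>M\<^esub>}"
      using XD(2) rsubmoduleD(2)[OF M rsubmodule_sum[OF M Y Zs]] by auto
    then have "Y <+>\<^bsub>M\<^esub> Z = Y"
      using max rsubmodule_sum[OF M Y Zs] rsubmodule_sum_upper[OF M Y Zs] by blast
    then have "Z \<subseteq> ?E" using rsubmodule_sum_upper(2)[OF M Y Zs] XE by auto
    then show False using EZ Z by auto
  qed
  have Ks: "rsubmodule R M K" using K by (simp add: delta_small_def)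
  have "K <+>\<^bsub>M\<^esub> X \<subseteq> K <+>\<^bsub>M\<^esub> ?E" using XE(1) by (fastforce simp: set_add_def'[of M K])
  moreover have "K <+>\<^bsub>M\<^esub> ?E \<subseteq> carrier M"
    using rsubmoduleD(1)[OF M rsubmodule_sum[OF M Ks Es]] .
  ultimately have "carrier M = K <+>\<^bsub>M\<^esub> ?E" using KX by auto
  then have "carrier M = ?E"
    using K Es singular_factor_essential[OF M ess] unfolding delta_small_def by blast
  with X Y XY that show ?thesis unfolding direct_decomposition_def by blast
qed

lemma direct_decomposition_projection:
  fixes M :: "('r, 'm) rmodule"
  assumes M: "right_module R M" and dec: "direct_decomposition R M X Y"
  obtains \<pi> where "\<pi> \<in> rmodule_hom R M (M\<lparr>carrier := X\<rparr>)" and "\<And>x. x \<in> X \<Longrightarrow> \<pi> x = x"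
proof -
  interpret M: right_module R M by (fact M)
  have X: "rsubmodule R M X" and Y: "rsubmodule R M Y" and s: "carrier M = X <+>\<^bsub>M\<^esub> Y"
    and XY: "X \<inter> Y = {\<zero>\<^bsub>M\<^esub>}" using dec by (auto simp: direct_decomposition_def)
  note XD = rsubmoduleD[OF M X]
  note YD = rsubmoduleD[OF M Y]
  have uniq: "x = x'" if "x \<in> X" "y \<in> Y" "x' \<in> X" "y' \<in> Y" "x \<oplus>\<^bsub>M\<^esub> y = x' \<oplus>\<^bsub>M\<^esub> y'" for x y x' y'
  proof -
    have c: "x \<in> carrier M" "y \<in> carrier M" "x' \<in> carrier M" "y' \<in> carrier M"
      using that XD(1) YD(1) by auto
    have "\<ominus>\<^bsub>M\<^esub> x' \<oplus>\<^bsub>M\<^esub> x = \<ominus>\<^bsub>M\<^esub> x' \<oplus>\<^bsub>M\<^esub> (x \<oplus>\<^bsub>M\<^esub> y) \<oplus>\<^bsub>M\<^esub> \<ominus>\<^bsub>M\<^esub> y"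
      using c by (simp add: M.M.a_assoc M.M.r_neg)
    also have "\<dots> = y' \<oplus>\<^bsub>M\<^esub> \<ominus>\<^bsub>M\<^esub> y"
      using c that(5) by (simp add: M.M.r_neg1)
    finally have "\<ominus>\<^bsub>M\<^esub> x' \<oplus>\<^bsub>M\<^esub> x \<in> Y" using that YD by auto
    moreover have "\<ominus>\<^bsub>M\<^esub> x' \<oplus>\<^bsub>M\<^esub> x \<in> X" using that XD by auto
    ultimately have "\<ominus>\<^bsub>M\<^esub> x' \<oplus>\<^bsub>M\<^esub> x = \<zero>\<^bsub>M\<^esub>" using XY by auto
    then have "x' \<oplus>\<^bsub>M\<^esub> (\<ominus>\<^bsub>M\<^esub> x' \<oplus>\<^bsub>M\<^esub> x) = x'" using c by simp
    then show ?thesis using c by (simp add: M.M.r_neg2)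
  qed
  have "\<forall>m\<in>carrier M. \<exists>x. x \<in> X \<and> (\<exists>y\<in>Y. m = x \<oplus>\<^bsub>M\<^esub> y)"
    unfolding s by (auto simp: set_add_def')
  then obtain \<pi> where pX: "\<And>m. m \<in> carrier M \<Longrightarrow> \<pi> m \<in> X"
    and pY: "\<And>m. m \<in> carrier M \<Longrightarrow> \<exists>y\<in>Y. m = \<pi> m \<oplus>\<^bsub>M\<^esub> y" by metis
  have eq: "\<pi> m = x" if "m = x \<oplus>\<^bsub>M\<^esub> y" "x \<in> X" "y \<in> Y" for m x y
  proof -
    have "m \<in> carrier M" using that XD(1) YD(1) by auto
    then show ?thesis using pX pY uniq that by metis
  qed
  show ?thesis
  proof
    show "\<pi> x = x" if "x \<in> X" for x using eq[of x x "\<zero>\<^bsub>M\<^esub>"] that XD(1) YD(2) by auto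
    show "\<pi> \<in> rmodule_hom R M (M\<lparr>carrier := X\<rparr>)" unfolding rmodule_hom_def
    proof (safe, goal_cases)
      case (1 x) then show ?case using pX by simp
    next
      case (2 a b)
      obtain y y' where y: "y \<in> Y" "a = \<pi> a \<oplus>\<^bsub>M\<^esub> y" "y' \<in> Y" "b = \<pi> b \<oplus>\<^bsub>M\<^esub> y'" using pY[OF 2(1)] pY[OF 2(2)] by metis
      have c: "y \<in> carrier M" "y' \<in> carrier M" "\<pi> a \<in> carrier M" "\<pi> b \<in> carrier M"
        using subsetD[OF YD(1)] y(1,3) subsetD[OF XD(1) pX] 2 by simp_all
      have "a \<oplus>\<^bsub>M\<^esub> b = (\<pi> a \<oplus>\<^bsub>M\<^esub> y) \<oplus>\<^bsub>M\<^esub> (\<pi> b \<oplus>\<^bsub>M\<^esub> y')"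
        by (rule arg_cong2[OF y(2,4)])
      also have "\<dots> = (\<pi> a \<oplus>\<^bsub>M\<^esub> \<pi> b) \<oplus>\<^bsub>M\<^esub> (y \<oplus>\<^bsub>M\<^esub> y')" using c by (simp add: M.M.a_ac)
      finally have "\<pi> (a \<oplus>\<^bsub>M\<^esub> b) = \<pi> a \<oplus>\<^bsub>M\<^esub> \<pi> b"
        using XD(3)[OF pX[OF 2(1)] pX[OF 2(2)]] YD(3)[OF y(1,3)] by (rule eq)
      then show ?case by simp
    next
      case (3 a r)
      obtain y where y: "y \<in> Y" "a = \<pi> a \<oplus>\<^bsub>M\<^esub> y" by (rule bexE[OF pY[OF 3(1)]])
      have c: "y \<in> carrier M" "\<pi> a \<in> carrier M" 
        using subsetD[OF YD(1) y(1)] subsetD[OF XD(1) pX[OF 3(1)]] by simp_all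
      have "a \<cdot>\<^bsub>M\<^esub> r = (\<pi> a \<oplus>\<^bsub>M\<^esub> y) \<cdot>\<^bsub>M\<^esub> r"
        by (rule arg_cong[OF y(2)])
      also have "\<dots> = \<pi> a \<cdot>\<^bsub>M\<^esub> r \<oplus>\<^bsub>M\<^esub> y \<cdot>\<^bsub>M\<^esub> r" by (rule M.rsmult_l_distr[OF c(2,1) 3(2)])
      finally have "\<pi> (a \<cdot>\<^bsub>M\<^esub> r) = \<pi> a \<cdot>\<^bsub>M\<^esub> r"
        using XD(5)[OF pX[OF 3(1)] 3(2)] YD(5)[OF y(1) 3(2)] by (rule eq)
      then show ?case by simp
    qed
  qed
qed

lemma projective_rmodule_retract:
  fixes P :: "('r, 'p) rmodule" and Q :: "('r, 'q) rmodule"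
  assumes P: "projective_rmodule R P" and Q: "right_module R Q"
    and i: "i \<in> rmodule_hom R Q P" and p: "p \<in> rmodule_hom R P Q"
    and pi: "\<And>x. x \<in> carrier Q \<Longrightarrow> p (i x) = x"
  shows "projective_rmodule R Q"
  unfolding projective_rmodule_def
proof (intro conjI allI impI Q)
  fix A :: "('r, 'q \<Rightarrow> 'r) rmodule" and B :: "('r, 'q) rmodule" and g f
  assume *: "right_module R A \<and> right_module R B \<and> g \<in> rmodule_epi R A B \<and> f \<in> rmodule_hom R Q B"
  then obtain h where h: "h \<in> rmodule_hom R P A" "\<forall>x\<in>carrier P. g (h x) = f (p x)"
    using projective_rmodule_lift[OF P, of A B g "\<lambda>x. f (p x)"] rmodule_hom_comp[OF p] by blast
  show "\<exists>h\<in>rmodule_hom R Q A. \<forall>x\<in>carrier Q. g (h x) = f x"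
  proof (intro bexI ballI)
    show "(\<lambda>x. h (i x)) \<in> rmodule_hom R Q A" by (rule rmodule_hom_comp[OF i h(1)])
    show "g (h (i x)) = f x" if "x \<in> carrier Q" for x
      using h(2) rmodule_homD(1)[OF i that] pi[OF that] by simp
  qed
qed

lemma has_projective_delta_coverI:
  fixes P :: "('r, 'p) rmodule" and L :: "('r, 'l) rmodule"
  assumes L: "right_module R L" and cov: "projective_delta_cover R P f L"
  shows "has_projective_delta_cover R L"
proof -
  interpret L: right_module R L by (fact L)
  let ?F = "free_rmodule R (carrier L)"
  let ?K = "a_kernel P L f"
  have proj: "projective_rmodule R P" and f: "f \<in> rmodule_hom R P L"
    and surj: "f ` carrier P = carrier L" and K: "delta_small R P ?K"
    using cov by (auto simp: projective_delta_cover_def rmodule_epi_def)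
  note fh = rmodule_homD[OF f]
  have P: "right_module R P" using proj by (simp add: projective_rmodule_def)
  interpret P: right_module R P by (fact P)
  have F: "right_module R ?F" by (rule free_rmodule_right_module) (rule L.R.ring_axioms)
  have "\<forall>l\<in>carrier L. \<exists>x. x \<in> carrier P \<and> f x = l" using surj by (metis imageE)
  then obtain a where a: "a \<in> carrier L \<rightarrow> carrier P" and fa: "\<And>l. l \<in> carrier L \<Longrightarrow> f (a l) = l"
    by (metis Pi_I)
  let ?e = "free_ext R P a"
  have e: "?e \<in> rmodule_hom R ?F P" by (rule free_ext_hom[OF P a])
  let ?X = "?e ` carrier ?F"
  have X: "rsubmodule R P ?X" by (rule rmodule_hom_image[OF F P e carrier_rsubmodule[OF F]])
  note XD = rsubmoduleD[OF P X]
  have aX: "a l \<in> ?X" if "l \<in> carrier L" for l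
    using free_ext_surj[OF P a that] by (metis imageI)
  have "carrier P \<subseteq> ?K <+>\<^bsub>P\<^esub> ?X"
  proof
    fix x assume x: "x \<in> carrier P"
    let ?y = "a (f x)"
    have y: "?y \<in> ?X" "?y \<in> carrier P" "f ?y = f x" using aX fa fh(1)[OF x] a by auto
    let ?k = "x \<oplus>\<^bsub>P\<^esub> \<ominus>\<^bsub>P\<^esub> ?y"
    have my: "\<ominus>\<^bsub>P\<^esub> ?y \<in> carrier P" using y by simp
    have "f ?k = f ?y \<oplus>\<^bsub>L\<^esub> f (\<ominus>\<^bsub>P\<^esub> ?y)" using fh(2)[OF x my] y(3) by simp
    also have "\<dots> = f (?y \<oplus>\<^bsub>P\<^esub> \<ominus>\<^bsub>P\<^esub> ?y)" using fh(2)[OF y(2) my] by simp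
    also have "\<dots> = \<zero>\<^bsub>L\<^esub>" using y(2) rmodule_hom_zero[OF P L f] by (simp add: P.M.r_neg)
    finally have "?k \<in> ?K" using x my by (simp add: a_kernel_def')
    moreover have "x = ?k \<oplus>\<^bsub>P\<^esub> ?y" using x y(2) by (simp add: P.M.a_assoc P.M.l_neg)
    ultimately show "x \<in> ?K <+>\<^bsub>P\<^esub> ?X" using y(1) unfolding set_add_def' by blast
  qed
  moreover have "?K <+>\<^bsub>P\<^esub> ?X \<subseteq> carrier P" using XD(1) by (auto simp: set_add_def' a_kernel_def')
  ultimately have "carrier P = ?K <+>\<^bsub>P\<^esub> ?X" by auto
  then obtain Y where "direct_decomposition R P ?X Y" by (rule delta_small_complement[OF P K X])
  then obtain \<pi> where \<pi>: "\<pi> \<in> rmodule_hom R P (P\<lparr>carrier := ?X\<rparr>)" and \<pi>X: "\<And>x. x \<in> ?X \<Longrightarrow> \<pi> x = x"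
    using direct_decomposition_projection[OF P] by blast
  have "?e \<in> rmodule_epi R ?F (P\<lparr>carrier := ?X\<rparr>)"
    using e by (auto simp: rmodule_epi_def rmodule_hom_def)
  then obtain h where h: "h \<in> rmodule_hom R P ?F" and eh: "\<And>x. x \<in> carrier P \<Longrightarrow> ?e (h x) = \<pi> x"
    using projective_rmodule_lift[OF proj F rsubmodule_right_module[OF P X] _ \<pi>] by blast
  let ?Q = "?F\<lparr>carrier := h ` ?X\<rparr>"
  have hX: "rsubmodule R ?F (h ` ?X)" by (rule rmodule_hom_image[OF P F h X])
  have Q: "right_module R ?Q" by (rule rsubmodule_right_module[OF F hX])
  have QF: "carrier ?Q \<subseteq> carrier ?F" using rsubmoduleD(1)[OF F hX] by simp
  have i: "?e \<in> rmodule_hom R ?Q P"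
    unfolding rmodule_hom_def mem_Collect_eq
  proof (intro conjI ballI Pi_I)
    fix x y r assume x: "x \<in> carrier ?Q"
    then have xF: "x \<in> carrier ?F" using QF by (rule subsetD[rotated])
    show "?e x \<in> carrier P" by (rule rmodule_homD(1)[OF e xF])
    show "?e (x \<oplus>\<^bsub>?Q\<^esub> y) = ?e x \<oplus>\<^bsub>P\<^esub> ?e y" if "y \<in> carrier ?Q"
      using rmodule_homD(2)[OF e xF subsetD[OF QF that]] by simp
    show "?e (x \<cdot>\<^bsub>?Q\<^esub> r) = ?e x \<cdot>\<^bsub>P\<^esub> r" if "r \<in> carrier R"
      using rmodule_homD(3)[OF e xF that] by simp
  qed
  have \<pi>c: "\<pi> x \<in> ?X" if "x \<in> carrier P" for x using rmodule_homD(1)[OF \<pi> that] by simp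
  let ?\<rho> = "\<lambda>x. h (\<pi> x)"
  have \<rho>: "?\<rho> \<in> rmodule_hom R P ?Q"
    unfolding rmodule_hom_def mem_Collect_eq
  proof (intro conjI ballI)
    show "?\<rho> \<in> carrier P \<rightarrow> carrier ?Q" using \<pi>c by simp
  next
    fix x y assume "x \<in> carrier P" "y \<in> carrier P"
    then show "?\<rho> (x \<oplus>\<^bsub>P\<^esub> y) = ?\<rho> x \<oplus>\<^bsub>?Q\<^esub> ?\<rho> y"
      using rmodule_homD(2)[OF \<pi>] rmodule_homD(2)[OF h] \<pi>c XD(1) by (simp add: subset_iff)
  next
    fix x r assume "x \<in> carrier P" "r \<in> carrier R"
    then show "?\<rho> (x \<cdot>\<^bsub>P\<^esub> r) = ?\<rho> x \<cdot>\<^bsub>?Q\<^esub> r"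
      using rmodule_homD(3)[OF \<pi>] rmodule_homD(3)[OF h] \<pi>c XD(1) by (simp add: subset_iff)
  qed
  have \<rho>e: "?\<rho> (?e q) = q" if "q \<in> carrier ?Q" for q
  proof -
    obtain x where x: "x \<in> ?X" "q = h x" using \<open>q \<in> carrier ?Q\<close> by auto
    then have "?e q = x" using eh XD(1) \<pi>X by auto
    then show ?thesis using x \<pi>X by simp
  qed
  have Qproj: "projective_rmodule R ?Q" by (rule projective_rmodule_retract[OF proj Q i \<rho> \<rho>e])
  let ?q = "\<lambda>x. f (?e x)"
  have q: "?q \<in> rmodule_hom R ?Q L" by (rule rmodule_hom_comp[OF i f])
  have "carrier L \<subseteq> ?q ` carrier ?Q"
  proof
    fix l assume l: "l \<in> carrier L"
    have "?e (h (a l)) = a l" using eh \<pi>X aX[OF l] XD(1) by auto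
    then have "l = ?q (h (a l))" using fa[OF l] by simp
    moreover have "h (a l) \<in> carrier ?Q" using aX[OF l] by simp
    ultimately show "l \<in> ?q ` carrier ?Q" by (rule image_eqI)
  qed
  moreover have "?q ` carrier ?Q \<subseteq> carrier L" by (rule image_subsetI) (rule rmodule_homD(1)[OF q])
  ultimately have qepi: "?q \<in> rmodule_epi R ?Q L"
    using q unfolding rmodule_epi_def by blast
  have \<rho>epi: "?\<rho> \<in> rmodule_epi R P ?Q"
  proof -
    have "carrier ?Q \<subseteq> ?\<rho> ` carrier P"
    proof
      fix x assume x: "x \<in> carrier ?Q"
      show "x \<in> ?\<rho> ` carrier P"
        by (rule image_eqI[where x = "?e x"]) (use \<rho>e[OF x] rmodule_homD(1)[OF i x] in simp_all)
    qed
    moreover have "?\<rho> ` carrier P \<subseteq> carrier ?Q" by (rule image_subsetI) (rule rmodule_homD(1)[OF \<rho>])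
    ultimately show ?thesis using \<rho> unfolding rmodule_epi_def by blast
  qed
  have zL: "rsubmodule R L {\<zero>\<^bsub>L\<^esub>}" by (rule rsubmoduleI[OF L]) auto
  have ker: "rsubmodule R ?Q (a_kernel ?Q L ?q)"
    using rmodule_hom_vimage[OF Q L q zL] by (simp add: a_kernel_def')
  have sub: "a_kernel ?Q L ?q \<subseteq> ?\<rho> ` ?K"
  proof
    fix x assume "x \<in> a_kernel ?Q L ?q"
    then have x: "x \<in> carrier ?Q" "f (?e x) = \<zero>\<^bsub>L\<^esub>" by (simp_all add: a_kernel_def')
    then have "?e x \<in> ?K" using rmodule_homD(1)[OF i x(1)] by (simp add: a_kernel_def')
    then show "x \<in> ?\<rho> ` ?K" using \<rho>e[OF x(1)] by (intro image_eqI[where x = "?e x"]) simp_all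
  qed
  have "delta_small R ?Q (a_kernel ?Q L ?q)"
    by (rule delta_small_image[OF P Q \<rho>epi K ker sub])
  with Qproj qepi have "projective_delta_cover R ?Q ?q L"
    by (simp add: projective_delta_cover_def)
  then show ?thesis unfolding has_projective_delta_cover_def by blast
qed

end

theory Submission
  imports Defs
begin

text \<open>
  If \<open>M = A \<oplus> B\<close> with \<open>A \<le> mR\<close>, then the restriction to \<open>B\<close> of the canonical map \<open>M \<rightarrow> M/mR\<close> is onto
  with kernel \<open>mR \<inter> B\<close>, so it is a projective \<open>\<delta>\<close>-cover as soon as \<open>mR \<inter> B\<close> is \<open>\<delta>\<close>-small.
  Conversely, lift the canonical map along a projective \<open>\<delta>\<close>-cover \<open>f : P \<rightarrow> M/mR\<close> to \<open>h : M \<rightarrow> P\<close>.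
  Then \<open>P = Ker f + h(M)\<close>, so \<open>h(M)\<close> is a direct summand of \<open>P\<close>.  Lifting the projection
  \<open>P \<rightarrow> h(M)\<close> along \<open>h\<close> gives \<open>g : P \<rightarrow> M\<close> such that \<open>g \<circ> h\<close> is idempotent; its kernel
  \<open>Ker h \<le> mR\<close> and its image are the required summands, since \<open>mR \<inter> g(h(M))\<close> lies in the image
  of \<open>Ker f\<close>.
\<close>

lemma rmodule_hom_restrict:
  fixes M :: "('r, 'm) rmodule"
  assumes "f \<in> rmodule_hom R M N" and "X \<subseteq> carrier M"
  shows "f \<in> rmodule_hom R (M\<lparr>carrier := X\<rparr>) N"
  using assms unfolding rmodule_hom_def by (auto simp: subset_iff)

lemma rmodule_hom_corestrict:
  fixes N :: "('r, 'n) rmodule"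
  assumes "f \<in> rmodule_hom R M N" and "f ` carrier M \<subseteq> Y"
  shows "f \<in> rmodule_hom R M (N\<lparr>carrier := Y\<rparr>)"
  using assms unfolding rmodule_hom_def by auto

lemma rmodule_hom_extend:
  fixes N :: "('r, 'n) rmodule"
  assumes "f \<in> rmodule_hom R M (N\<lparr>carrier := Y\<rparr>)" and "Y \<subseteq> carrier N"
  shows "f \<in> rmodule_hom R M N"
  using assms unfolding rmodule_hom_def by (auto simp: subset_iff)

lemma factor_rmodule_epi:
  fixes M :: "('r, 'm) rmodule"
  assumes M: "right_module R M" and N: "rsubmodule R M N"
  shows "(\<lambda>x. N +>\<^bsub>M\<^esub> x) \<in> rmodule_epi R M (factor_rmodule M N)"
proof -
  have "(\<lambda>x. N +>\<^bsub>M\<^esub> x) ` carrier M = carrier (factor_rmodule M N)"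
    by (auto simp: factor_rmodule_def A_RCOSETS_def')
  then show ?thesis unfolding rmodule_epi_def rmodule_hom_def
    using factor_rmodule_add[OF M N] factor_rmodule_rsmult[OF M N] by auto
qed

lemma factor_rmodule_coset_eq_zero_iff:
  fixes M :: "('r, 'm) rmodule"
  assumes "right_module R M" and "rsubmodule R M N" and "x \<in> carrier M"
  shows "N +>\<^bsub>M\<^esub> x = \<zero>\<^bsub>factor_rmodule M N\<^esub> \<longleftrightarrow> x \<in> N"
  using a_r_coset_rsubmodule_eq_iff[OF assms] by (simp add: factor_rmodule_def)

lemma direct_decomposition_commute:
  assumes M: "right_module R M" and dec: "direct_decomposition R M A B"
  shows "direct_decomposition R M B A"
proof -
  interpret M: right_module R M by (fact M)
  have "A \<subseteq> carrier M" "B \<subseteq> carrier M"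
    using dec rsubmoduleD(1)[OF M] by (auto simp: direct_decomposition_def)
  then have "A <+>\<^bsub>M\<^esub> B = B <+>\<^bsub>M\<^esub> A"
    unfolding set_add_def' by (fastforce simp: M.M.a_comm subset_iff)
  then show ?thesis using dec by (auto simp: direct_decomposition_def)
qed

text \<open>The inclusion of \<open>A\<close> and the projection onto \<open>A\<close> along
  \<open>B\<close> make \<open>A\<close> a retract of \<open>M\<close>, and projectivity passes to
  retracts.\<close>

lemma projective_rmodule_direct_summand:
  fixes M :: "('r, 'm) rmodule"
  assumes proj: "projective_rmodule R M" and dec: "direct_decomposition R M A B"
  shows "projective_rmodule R (M\<lparr>carrier := A\<rparr>)"
proof -
  have M: "right_module R M" using proj by (simp add: projective_rmodule_def)
  have A: "rsubmodule R M A" using dec by (simp add: direct_decomposition_def)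
  obtain \<pi> where \<pi>: "\<pi> \<in> rmodule_hom R M (M\<lparr>carrier := A\<rparr>)" "\<And>x. x \<in> A \<Longrightarrow> \<pi> x = x"
    using direct_decomposition_projection[OF M dec] by blast
  have "(\<lambda>x. x) \<in> rmodule_hom R (M\<lparr>carrier := A\<rparr>) M"
    using rsubmoduleD(1)[OF M A] by (auto simp: rmodule_hom_def)
  then show ?thesis
    using projective_rmodule_retract[OF proj rsubmodule_right_module[OF M A] _ \<pi>(1)] \<pi>(2) by simp
qed

text \<open>Write x = (x - e x) + e x, where the first term is killed by \<open>e\<close>. An
  element e y of the kernel is zero because e y = e (e y).\<close>

lemma rmodule_hom_idempotent_decomposition:
  fixes M :: "('r, 'm) rmodule"
  assumes M: "right_module R M" and e: "e \<in> rmodule_hom R M M"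
    and idem: "\<And>x. x \<in> carrier M \<Longrightarrow> e (e x) = e x"
  shows "direct_decomposition R M (a_kernel M M e) (e ` carrier M)"
  unfolding direct_decomposition_def
proof (intro conjI)
  interpret M: right_module R M by (fact M)
  note eD = rmodule_homD[OF e]
  have "rsubmodule R M {\<zero>\<^bsub>M\<^esub>}" by (rule rsubmoduleI[OF M]) auto
  from rmodule_hom_vimage[OF M M e this] show K: "rsubmodule R M (a_kernel M M e)"
    by (simp add: a_kernel_def')
  show I: "rsubmodule R M (e ` carrier M)"
    by (rule rmodule_hom_image[OF M M e carrier_rsubmodule[OF M]])
  have "x \<in> a_kernel M M e <+>\<^bsub>M\<^esub> e ` carrier M" if x: "x \<in> carrier M" for x
  proof -
    let ?k = "x \<oplus>\<^bsub>M\<^esub> \<ominus>\<^bsub>M\<^esub> e x"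
    have ex: "e x \<in> carrier M" "\<ominus>\<^bsub>M\<^esub> e x \<in> carrier M" using eD(1)[OF x] by simp_all
    have "e ?k = e (e x) \<oplus>\<^bsub>M\<^esub> e (\<ominus>\<^bsub>M\<^esub> e x)" using eD(2)[OF x ex(2)] idem[OF x] by simp
    also have "\<dots> = e (e x \<oplus>\<^bsub>M\<^esub> \<ominus>\<^bsub>M\<^esub> e x)" using eD(2)[OF ex] by simp
    also have "\<dots> = \<zero>\<^bsub>M\<^esub>" using ex(1) rmodule_hom_zero[OF M M e] by (simp add: M.M.r_neg)
    finally have "?k \<in> a_kernel M M e" using x ex by (simp add: a_kernel_def')
    moreover have "x = ?k \<oplus>\<^bsub>M\<^esub> e x" using x ex by (simp add: M.M.a_assoc M.M.l_neg)
    ultimately show ?thesis using x unfolding set_add_def' by blast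
  qed
  then show "carrier M = a_kernel M M e <+>\<^bsub>M\<^esub> e ` carrier M"
    using rsubmoduleD(1)[OF M rsubmodule_sum[OF M K I]] by blast
  show "a_kernel M M e \<inter> e ` carrier M = {\<zero>\<^bsub>M\<^esub>}"
    using rsubmoduleD(2)[OF M K] rsubmoduleD(2)[OF M I] idem by (auto simp: a_kernel_def')
qed

text \<open>The summand \<open>B\<close> with the restricted coset map is the cover. It lives on the
  type of \<open>M\<close>, so \<open>has_projective_delta_coverI\<close> moves it to the type fixed
  in the definition.\<close>

lemma has_projective_delta_cover_factor:
  fixes M :: "('r, 'm) rmodule"
  assumes proj: "projective_rmodule R M" and N: "rsubmodule R M N"
    and dec: "direct_decomposition R M A B" and AN: "A \<subseteq> N"
    and small: "delta_small R (M\<lparr>carrier := B\<rparr>) (N \<inter> B)"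
  shows "has_projective_delta_cover R (factor_rmodule M N)"
proof (rule has_projective_delta_coverI)
  have M: "right_module R M" using proj by (simp add: projective_rmodule_def)
  interpret M: right_module R M by (fact M)
  let ?L = "factor_rmodule M N" and ?B = "M\<lparr>carrier := B\<rparr>"
  let ?p = "\<lambda>x. N +>\<^bsub>M\<^esub> x"
  show L: "right_module R ?L" by (rule factor_rmodule_right_module[OF M N])
  have A: "rsubmodule R M A" and B: "rsubmodule R M B" and s: "carrier M = A <+>\<^bsub>M\<^esub> B"
    using dec by (auto simp: direct_decomposition_def)
  note ND = rsubmoduleD[OF M N] and BD = rsubmoduleD(1)[OF M B]
  have p: "?p \<in> rmodule_hom R M ?L" "?p ` carrier M = carrier ?L"
    using factor_rmodule_epi[OF M N] by (simp_all add: rmodule_epi_def)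
  \<comment> \<open>The component of x in \<open>A\<close> lies in \<open>N\<close>, so it does not
    change the coset: x and its component in \<open>B\<close> have the same image.\<close>
  have "?p x \<in> ?p ` B" if x: "x \<in> carrier M" for x
  proof -
    obtain a b where ab: "a \<in> A" "b \<in> B" "x = a \<oplus>\<^bsub>M\<^esub> b"
      using x unfolding s by (auto simp: set_add_def')
    then have c: "a \<in> carrier M" "b \<in> carrier M" "a \<in> N" using AN ND(1) BD by auto
    have "?p x = (N +>\<^bsub>M\<^esub> a) +>\<^bsub>M\<^esub> b"
      using ab(3) c ND(1) by (simp add: M.M.a_coset_add_assoc)
    also have "\<dots> = ?p b" using a_r_coset_rsubmodule_eq_iff[OF M N c(1)] c(3) by simp
    finally show ?thesis using ab(2) by blast
  qed
  then have "?p ` carrier M \<subseteq> ?p ` B" by (rule image_subsetI)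
  then have "?p ` B = carrier ?L"
    using image_mono[OF BD, of ?p] unfolding p(2) by (rule equalityI[rotated])
  then have "?p \<in> rmodule_epi R ?B ?L"
    using rmodule_hom_restrict[OF p(1) BD] by (simp add: rmodule_epi_def)
  moreover have "a_kernel ?B ?L ?p = N \<inter> B"
    using factor_rmodule_coset_eq_zero_iff[OF M N] BD by (auto simp: a_kernel_def')
  moreover have "projective_rmodule R ?B"
    by (rule projective_rmodule_direct_summand[OF proj direct_decomposition_commute[OF M dec]])
  ultimately show "projective_delta_cover R ?B ?p ?L"
    using small by (simp add: projective_delta_cover_def)
qed

text \<open>Both projectivity assumptions enter: that of \<open>M\<close> to lift the coset map
  along \<open>f\<close>, that of \<open>P\<close> to lift a projection back along the resulting
  map.\<close>

lemma projective_delta_cover_factor_decomposition: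
  fixes M :: "('r, 'm) rmodule" and P :: "('r, 'p) rmodule"
  assumes proj: "projective_rmodule R M" and N: "rsubmodule R M N"
    and cov: "projective_delta_cover R P f (factor_rmodule M N)"
  obtains A B where "direct_decomposition R M A B" and "A \<subseteq> N"
    and "delta_small R (M\<lparr>carrier := B\<rparr>) (N \<inter> B)"
proof -
  have M: "right_module R M" using proj by (simp add: projective_rmodule_def)
  interpret M: right_module R M by (fact M)
  let ?L = "factor_rmodule M N"
  let ?p = "\<lambda>x. N +>\<^bsub>M\<^esub> x"
  let ?K = "a_kernel P ?L f"
  have L: "right_module R ?L" by (rule factor_rmodule_right_module[OF M N])
  have projP: "projective_rmodule R P" and fepi: "f \<in> rmodule_epi R P ?L"
    and K: "delta_small R P ?K"
    using cov by (auto simp: projective_delta_cover_def)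
  have P: "right_module R P" using projP by (simp add: projective_rmodule_def)
  interpret P: right_module R P by (fact P)
  have f: "f \<in> rmodule_hom R P ?L" using fepi by (simp add: rmodule_epi_def)
  note fD = rmodule_homD[OF f]
  have p: "?p \<in> rmodule_hom R M ?L" "?p ` carrier M = carrier ?L"
    using factor_rmodule_epi[OF M N] by (simp_all add: rmodule_epi_def)
  obtain h where h: "h \<in> rmodule_hom R M P" and fh: "\<And>x. x \<in> carrier M \<Longrightarrow> f (h x) = ?p x"
    using projective_rmodule_lift[OF proj P L fepi p(1)] by blast
  note hD = rmodule_homD[OF h]
  let ?X = "h ` carrier M"
  have X: "rsubmodule R P ?X" by (rule rmodule_hom_image[OF M P h carrier_rsubmodule[OF M]])
  have Ks: "rsubmodule R P ?K" using K by (simp add: delta_small_def)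
  \<comment> \<open>Choose x in \<open>M\<close> whose coset is f y; then y and h x have the same
    image under \<open>f\<close>, so y - h x lies in the kernel.\<close>
  have "y \<in> ?K <+>\<^bsub>P\<^esub> ?X" if y: "y \<in> carrier P" for y
  proof -
    obtain x where x: "x \<in> carrier M" "?p x = f y" using fD(1)[OF y] p(2) by (metis imageE)
    have hx: "h x \<in> carrier P" "\<ominus>\<^bsub>P\<^esub> h x \<in> carrier P" using hD(1)[OF x(1)] by simp_all
    let ?k = "y \<oplus>\<^bsub>P\<^esub> \<ominus>\<^bsub>P\<^esub> h x"
    have "f ?k = f (h x) \<oplus>\<^bsub>?L\<^esub> f (\<ominus>\<^bsub>P\<^esub> h x)"
      using fD(2)[OF y hx(2)] fh[OF x(1)] x(2) by simp
    also have "\<dots> = f (h x \<oplus>\<^bsub>P\<^esub> \<ominus>\<^bsub>P\<^esub> h x)" using fD(2)[OF hx] by simp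
    also have "\<dots> = \<zero>\<^bsub>?L\<^esub>" using hx(1) rmodule_hom_zero[OF P L f] by (simp add: P.M.r_neg)
    finally have "?k \<in> ?K" using y hx by (simp add: a_kernel_def')
    moreover have "y = ?k \<oplus>\<^bsub>P\<^esub> h x" using y hx by (simp add: P.M.a_assoc P.M.l_neg)
    ultimately show ?thesis using x(1) unfolding set_add_def' by blast
  qed
  then have "carrier P = ?K <+>\<^bsub>P\<^esub> ?X"
    using rsubmoduleD(1)[OF P rsubmodule_sum[OF P Ks X]] by blast
  \<comment> \<open>The factor of \<open>P\<close> by h(M) need not be singular, so
    \<delta>-smallness of the kernel yields a complement of h(M) rather than h(M) = P.\<close>
  then obtain Y where "direct_decomposition R P ?X Y" by (rule delta_small_complement[OF P K X])
  then obtain \<pi> where \<pi>: "\<pi> \<in> rmodule_hom R P (P\<lparr>carrier := ?X\<rparr>)"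
    and \<pi>X: "\<And>x. x \<in> ?X \<Longrightarrow> \<pi> x = x"
    using direct_decomposition_projection[OF P] by blast
  have "h \<in> rmodule_epi R M (P\<lparr>carrier := ?X\<rparr>)"
    using rmodule_hom_corestrict[OF h subset_refl] by (simp add: rmodule_epi_def)
  then obtain g where g: "g \<in> rmodule_hom R P M" and hg: "\<And>y. y \<in> carrier P \<Longrightarrow> h (g y) = \<pi> y"
    using projective_rmodule_lift[OF projP M rsubmodule_right_module[OF P X] _ \<pi>] by blast
  let ?e = "\<lambda>x. g (h x)"
  have e: "?e \<in> rmodule_hom R M M" by (rule rmodule_hom_comp[OF h g])
  \<comment> \<open>Since h (g y) = \<pi> y and \<pi> fixes h(M), composing with \<open>?e\<close>
    leaves \<open>h\<close> unchanged. Applying \<open>g\<close> shows that \<open>?e\<close> is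
    idempotent; it also follows that its kernel is contained in that of \<open>h\<close>.\<close>
  have he: "h (?e x) = h x" if "x \<in> carrier M" for x
    using hg[OF hD(1)[OF that]] \<pi>X[OF imageI[OF that]] by simp
  let ?A = "a_kernel M M ?e" and ?B = "?e ` carrier M"
  have dec: "direct_decomposition R M ?A ?B"
    by (rule rmodule_hom_idempotent_decomposition[OF M e]) (simp add: he)
  have B: "rsubmodule R M ?B" using dec by (simp add: direct_decomposition_def)
  have AN: "?A \<subseteq> N"
  proof
    fix x assume "x \<in> ?A"
    then have x: "x \<in> carrier M" "?e x = \<zero>\<^bsub>M\<^esub>" by (simp_all add: a_kernel_def')
    have "h x = \<zero>\<^bsub>P\<^esub>" using he[OF x(1)] x(2) rmodule_hom_zero[OF M P h] by simp
    then have "?p x = \<zero>\<^bsub>?L\<^esub>" using fh[OF x(1)] rmodule_hom_zero[OF P L f] by simp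
    then show "x \<in> N" using factor_rmodule_coset_eq_zero_iff[OF M N x(1)] by simp
  qed
  let ?BM = "M\<lparr>carrier := ?B\<rparr>"
  have BM: "right_module R ?BM" by (rule rsubmodule_right_module[OF M B])
  \<comment> \<open>This map carries \<delta>-smallness from \<open>P\<close> to \<open>?B\<close>.
    Projecting by \<pi> first forces the image to be g(h(M)), which is exactly
    \<open>?B\<close>.\<close>
  let ?\<rho> = "\<lambda>y. g (\<pi> y)"
  have \<pi>P: "\<pi> \<in> rmodule_hom R P P" by (rule rmodule_hom_extend[OF \<pi> rsubmoduleD(1)[OF P X]])
  have \<rho>M: "?\<rho> \<in> rmodule_hom R P M" by (rule rmodule_hom_comp[OF \<pi>P g])
  have \<rho>im: "?\<rho> ` carrier P = ?B"
  proof
    show "?\<rho> ` carrier P \<subseteq> ?B"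
    proof (rule image_subsetI)
      fix y assume "y \<in> carrier P"
      then have "\<pi> y \<in> ?X" using rmodule_homD(1)[OF \<pi>] by simp
      then obtain x where "x \<in> carrier M" "\<pi> y = h x" by blast
      then show "?\<rho> y \<in> ?B" by simp
    qed
    have "?e x = ?\<rho> (h x)" if "x \<in> carrier M" for x using \<pi>X[OF imageI[OF that]] by simp
    then show "?B \<subseteq> ?\<rho> ` carrier P" using hD(1) by blast
  qed
  have \<rho>: "?\<rho> \<in> rmodule_epi R P ?BM"
    using rmodule_hom_corestrict[OF \<rho>M] \<rho>im by (simp add: rmodule_epi_def)
  have NB: "rsubmodule R ?BM (N \<inter> ?B)"
    using rsubmoduleD[OF M N] rsubmoduleD[OF M B] by (intro rsubmoduleI[OF BM]) auto
  \<comment> \<open>The preimage of b is h b: it lies in the kernel of \<open>f\<close> because f (h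
    b) is the coset of b, which is zero, and \<open>?\<rho>\<close> sends it to g (h b) = b, since b
    is fixed by the idempotent \<open>?e\<close>.\<close>
  have "N \<inter> ?B \<subseteq> ?\<rho> ` ?K"
  proof
    fix b assume b: "b \<in> N \<inter> ?B"
    then obtain x where x: "x \<in> carrier M" "b = ?e x" by auto
    have bM: "b \<in> carrier M" using b rsubmoduleD(1)[OF M N] by auto
    have "f (h b) = \<zero>\<^bsub>?L\<^esub>"
      using fh[OF bM] factor_rmodule_coset_eq_zero_iff[OF M N bM] b by simp
    then have "h b \<in> ?K" using hD(1)[OF bM] by (simp add: a_kernel_def')
    moreover have "b = ?\<rho> (h b)" using \<pi>X[OF imageI[OF bM]] he[OF x(1)] x(2) by simp
    ultimately show "b \<in> ?\<rho> ` ?K" by (rule rev_image_eqI)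
  qed
  then have "delta_small R ?BM (N \<inter> ?B)" by (rule delta_small_image[OF P BM \<rho> K NB])
  with that[OF dec AN] show ?thesis .
qed

theorem theorem4p1:
  fixes R :: "('r, 'x) ring_scheme" and M :: "('r, 'm) rmodule"
  assumes "ring R" and "right_module R M" and "projective_rmodule R M"
  shows "principally_delta_semiperfect R M \<longleftrightarrow> principally_delta_lifting R M"
proof
  assume L: "principally_delta_semiperfect R M"
  show "principally_delta_lifting R M" unfolding principally_delta_lifting_def
  proof
    fix m assume m: "m \<in> carrier M"
    then obtain P :: "('r, 'm set \<Rightarrow> 'r) rmodule" and f
      where "projective_delta_cover R P f (factor_rmodule M (cyclic_rsubmodule R M m))"
      using L unfolding principally_delta_semiperfect_def has_projective_delta_cover_def by blast
    then show "\<exists>A B. direct_decomposition R M A B \<and> A \<subseteq> cyclic_rsubmodule R M m \<and>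
        delta_small R (M\<lparr>carrier := B\<rparr>) (cyclic_rsubmodule R M m \<inter> B)"
      by (rule projective_delta_cover_factor_decomposition[OF assms(3) cyclic_rsubmodule_rsubmodule[OF assms(2) m]]) blast
  qed
next
  assume L: "principally_delta_lifting R M"
  show "principally_delta_semiperfect R M" unfolding principally_delta_semiperfect_def
  proof
    fix m assume m: "m \<in> carrier M"
    then obtain A B where "direct_decomposition R M A B" "A \<subseteq> cyclic_rsubmodule R M m"
      "delta_small R (M\<lparr>carrier := B\<rparr>) (cyclic_rsubmodule R M m \<inter> B)"
      using L unfolding principally_delta_lifting_def by blast
    then show "has_projective_delta_cover R (factor_rmodule M (cyclic_rsubmodule R M m))"
      by (rule has_projective_delta_cover_factor[OF assms(3) cyclic_rsubmodule_rsubmodule[OF assms(2) m]])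
  qed
qed

end
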